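(* Let $k\ge g\ge 2$ be integers. For each $j\in\{1,\dots,g\}$ let $\beta_j,\alpha_{j,1},\alpha_{j,2}\in\mathbb{C}^*$ with $\alpha_{j,1}\neq\alpha_{j,2}$ be such that $\beta_jx^{2j-1}(x-\alpha_{j,1})(x-\alpha_{j,2})$ is a real polynomial. Let $C_j$ be the normalization of the compactification in $\mathbb{P}^1\times\mathbb{P}^1$ of the curve $y^2=\beta_jx^{2j-1}(x-\alpha_{j,1})(x-\alpha_{j,2})$, and let $H_j\subset H^0(C_j,\mathcal{L}_{\mathbb{R}}(2k\cdot\infty))$ be the real vector space spanned by $1,x,\dots,x^k;\ y,xy,\dots,x^{k-g-1}y$. Then the set of linear series $\{H_j:1\le j\le g\}$ satisfies the compatibility relation $$o_i(H_j,\infty)+o_{2k-g-i}(H_{j+1},0)=2k$$ for all $i=0,\dots,2k-g$ and all $j=1,\dots,g-1$, where $o(H_j,P)=(o_0(H_j,P),\dots,o_{2k-g}(H_j,P))$ denotes the set of vanishing orders of $H_j$ in the point $P\in C_j$, listed in strictly increasing order.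
   Context: $C_j$ is a real curve of genus $1$, with real structure induced by $(x,y)\mapsto(\overline{x},\overline{y})$. The points $0$ and $\infty$ of $C_j$ are the unique points lying over $x=0$ and $x=\infty$ under the degree-two map $(x,y)\mapsto x$. $\mathcal{L}_{\mathbb{R}}(2k\cdot\infty)$ is the real line bundle defined by the divisor $2k\cdot\infty$, whose real sections are identified with the real rational functions with poles at most of order $2k$ at $\infty$ and no other poles. Vanishing orders are taken as sections of this line bundle: a function $h$ vanishes at $p\ne\infty$ to order $\mathrm{ord}_p(h)$ and at $\infty$ to order $\mathrm{ord}_\infty(h)+2k$. The vanishing orders of $H_j$ at $P$ are the $2k-g+1$ distinct values taken by the vanishing order at $P$ on nonzero (complexified) elements of $H_j$. When $k=g$ the list $y,xy,\dots,x^{k-g-1}y$ is empty. *)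

theory Defs
  imports
    "HOL-Algebra.Polynomials"
    "HOL-Algebra.Embedded_Algebras"
    "HOL-Algebra.Generated_Rings"
    "HOL-Algebra.Ideal"
    "HOL-Computational_Algebra.Polynomial_Factorial"
    Complex_Main
begin

type_synonym ratfun = "complex poly fract"

definition curve_poly :: "nat \<Rightarrow> complex \<Rightarrow> complex \<Rightarrow> complex \<Rightarrow> complex poly" where
  "curve_poly j b a1 a2 =
     Polynomial.smult b (Polynomial.monom 1 (2 * j - 1) * [:- a1, 1:] * [:- a2, 1:])"

definition real_poly :: "complex poly \<Rightarrow> bool" where
  "real_poly p \<longleftrightarrow> (\<forall>i. Polynomial.coeff p i \<in> \<real>)"


section \<open>The function field of \<open>y\<^sup>2 = f(x)\<close>\<close>

text \<open>
  The ring \<open>\<complex>(x)[y] / (y\<^sup>2 - f)\<close>, the pair \<open>(a, b)\<close> standing for \<open>a + b y\<close>.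
  It is a field, the function field of the affine curve \<open>y\<^sup>2 = f(x)\<close>, whenever \<open>f\<close> is not a square.
\<close>

definition function_field :: "complex poly \<Rightarrow> (ratfun \<times> ratfun) ring" where
  "function_field f =
     \<lparr>carrier = UNIV,
      mult = (\<lambda>(a, b) (c, d). (a * c + b * d * to_fract f, a * d + b * c)),
      one = (1, 0),
      zero = (0, 0),
      add = (\<lambda>(a, b) (c, d). (a + c, b + d))\<rparr>"

definition const_fun :: "complex \<Rightarrow> ratfun \<times> ratfun" where
  "const_fun c = (to_fract [:c:], 0)"

definition x_fun :: "ratfun \<times> ratfun" where
  "x_fun = (to_fract [:0, 1:], 0)"

definition y_fun :: "ratfun \<times> ratfun" where
  "y_fun = (0, 1)"


section \<open>The normalization of the compactification in \<open>\<P>\<^sup>1 \<times> \<P>\<^sup>1\<close>\<close>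

text \<open>
  The closure in \<open>\<P>\<^sup>1 \<times> \<P>\<^sup>1\<close> of the affine curve is covered by its intersections with the four
  standard affine charts; their coordinate rings are the subrings \<open>\<complex>[x\<^bsup>\<plusminus>1\<^esup>, y\<^bsup>\<plusminus>1\<^esup>]\<close> of the
  function field.
\<close>

definition chart_rings :: "complex poly \<Rightarrow> (ratfun \<times> ratfun) set set" where
  "chart_rings f =
     {generate_ring (function_field f) (range const_fun \<union> {s, t}) | s t.
        s \<in> {x_fun, inv\<^bsub>function_field f\<^esub> x_fun} \<and>
        t \<in> {y_fun, inv\<^bsub>function_field f\<^esub> y_fun}}"

definition integral_closure :: "('a, 'b) ring_scheme \<Rightarrow> 'a set \<Rightarrow> 'a set" where
  "integral_closure K A =
     {h \<in> carrier K. \<exists>p \<in> carrier (univ_poly K A).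
        p \<noteq> [] \<and> hd p = \<one>\<^bsub>K\<^esub> \<and> ring.eval K p h = \<zero>\<^bsub>K\<^esub>}"

definition localization_at :: "('a, 'b) ring_scheme \<Rightarrow> 'a set \<Rightarrow> 'a set \<Rightarrow> 'a set" where
  "localization_at K B M = {a \<otimes>\<^bsub>K\<^esub> inv\<^bsub>K\<^esub> s | a s. a \<in> B \<and> s \<in> B - M}"

text \<open>
  A (closed, complex) point of the normalization is a maximal ideal of the integral closure of one
  of the chart rings. It is represented by its local ring inside the function field: this
  identifies the points that belong to several charts, and distinct points have distinct local
  rings.
\<close>

definition normalization_points :: "complex poly \<Rightarrow> (ratfun \<times> ratfun) set set" where
  "normalization_points f =
     {localization_at (function_field f) B M | A B M.
        A \<in> chart_rings f \<and> B = integral_closure (function_field f) A \<and>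
        maximalideal M (function_field f\<lparr>carrier := B\<rparr>)}"

definition local_max_ideal :: "complex poly \<Rightarrow> (ratfun \<times> ratfun) set \<Rightarrow> (ratfun \<times> ratfun) set" where
  "local_max_ideal f P = P - Units (function_field f\<lparr>carrier := P\<rparr>)"

definition point_zero :: "complex poly \<Rightarrow> (ratfun \<times> ratfun) set" where
  "point_zero f = (THE P. P \<in> normalization_points f \<and> x_fun \<in> local_max_ideal f P)"

definition point_infinity :: "complex poly \<Rightarrow> (ratfun \<times> ratfun) set" where
  "point_infinity f =
     (THE P. P \<in> normalization_points f \<and> inv\<^bsub>function_field f\<^esub> x_fun \<in> local_max_ideal f P)"

definition uniformizer :: "complex poly \<Rightarrow> (ratfun \<times> ratfun) set \<Rightarrow> ratfun \<times> ratfun \<Rightarrow> bool" where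
  "uniformizer f P t \<longleftrightarrow>
     t \<in> P \<and> local_max_ideal f P = PIdl\<^bsub>function_field f\<lparr>carrier := P\<rparr>\<^esub> t"

text \<open>Only meaningful for \<open>h \<noteq> 0\<close>, at a point whose local ring is a discrete valuation ring.\<close>

definition ord_at :: "complex poly \<Rightarrow> (ratfun \<times> ratfun) set \<Rightarrow> ratfun \<times> ratfun \<Rightarrow> int" where
  "ord_at f P h =
     (THE n. \<exists>t. uniformizer f P t \<and>
        (\<exists>u \<in> Units (function_field f\<lparr>carrier := P\<rparr>).
           h = u \<otimes>\<^bsub>function_field f\<^esub> (t [^]\<^bsub>function_field f\<^esub> n)))"


section \<open>Real sections and linear series\<close>

text \<open>
  For real \<open>f\<close>, the functions \<open>h\<close> with \<open>h(\<sigma> p) = cnj (h p)\<close> for the real structure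
  \<open>\<sigma>(x, y) = (cnj x, cnj y)\<close> are those of the form \<open>a + b y\<close> with \<open>a, b \<in> \<real>(x)\<close>.
\<close>

definition real_ratfuns :: "ratfun set" where
  "real_ratfuns = {to_fract p / to_fract q | p q. real_poly p \<and> real_poly q \<and> q \<noteq> 0}"

definition real_functions :: "(ratfun \<times> ratfun) set" where
  "real_functions = real_ratfuns \<times> real_ratfuns"

text \<open>The real sections of the line bundle of the divisor \<open>n \<cdot> \<infinity>\<close>.\<close>

definition real_sections :: "complex poly \<Rightarrow> nat \<Rightarrow> (ratfun \<times> ratfun) set" where
  "real_sections f n =
     {h \<in> real_functions.
        (\<forall>P \<in> normalization_points f. P \<noteq> point_infinity f \<longrightarrow> h \<in> P) \<and>
        (h \<noteq> \<zero>\<^bsub>function_field f\<^esub> \<longrightarrow> ord_at f (point_infinity f) h \<ge> - int n)}"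

definition linear_series :: "nat \<Rightarrow> nat \<Rightarrow> complex poly \<Rightarrow> (ratfun \<times> ratfun) set" where
  "linear_series g k f =
     ring.Span (function_field f) (const_fun ` \<real>)
       (map (\<lambda>i. x_fun [^]\<^bsub>function_field f\<^esub> i) [0..<k + 1] @
        map (\<lambda>i. (x_fun [^]\<^bsub>function_field f\<^esub> i) \<otimes>\<^bsub>function_field f\<^esub> y_fun) [0..<k - g])"

definition complexification :: "complex poly \<Rightarrow> (ratfun \<times> ratfun) set \<Rightarrow> (ratfun \<times> ratfun) set" where
  "complexification f H =
     {h1 \<oplus>\<^bsub>function_field f\<^esub> (const_fun \<i> \<otimes>\<^bsub>function_field f\<^esub> h2) | h1 h2. h1 \<in> H \<and> h2 \<in> H}"

text \<open>
  Vanishing orders are those of sections of the line bundle of \<open>n \<cdot> \<infinity>\<close>, whence the shift by \<open>n\<close>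
  at \<open>\<infinity>\<close>.
\<close>

definition vanishing_order ::
    "complex poly \<Rightarrow> nat \<Rightarrow> (ratfun \<times> ratfun) set \<Rightarrow> ratfun \<times> ratfun \<Rightarrow> int" where
  "vanishing_order f n P h = ord_at f P h + (if P = point_infinity f then int n else 0)"

definition vanishing_sequence ::
    "complex poly \<Rightarrow> nat \<Rightarrow> (ratfun \<times> ratfun) set \<Rightarrow> (ratfun \<times> ratfun) set \<Rightarrow> int list" where
  "vanishing_sequence f n H P =
     sorted_list_of_set
       (vanishing_order f n P ` (complexification f H - {\<zero>\<^bsub>function_field f\<^esub>}))"

end

theory Submission
  imports Defs "HOL-Computational_Algebra.Field_as_Ring"
    "HOL-Computational_Algebra.Fundamental_Theorem_Algebra"
begin

text \<open>
  Let \<open>F = \<complex>(x)\<close> and \<open>K = F(y)\<close> with \<open>y\<^sup>2 = f\<close>. At the points over \<open>x = 0\<close> and \<open>x = \<infinity>\<close> the double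
  cover ramifies, so the functions \<open>x\<^sup>i\<close> have even order there and the functions \<open>x\<^sup>i y\<close> odd order:
  with \<open>f = \<beta> x\<^bsup>2j-1\<^esup> (x - \<alpha>\<^sub>1) (x - \<alpha>\<^sub>2)\<close> the orders of \<open>x\<close> and \<open>y\<close> are \<open>2\<close> and \<open>2j - 1\<close> at \<open>0\<close>, and
  \<open>- 2\<close> and \<open>- (2j + 1)\<close> at \<open>\<infinity>\<close>. No cancellation can occur between \<open>p(x)\<close> and \<open>q(x) y\<close>, so the
  orders of \<open>H\<^sub>j\<close> are those of its generators. As sections, the generators of \<open>H\<^sub>j\<close> have at \<open>\<infinity>\<close> the
  orders \<open>2k - 2i\<close> and \<open>2k - 2i - (2j + 1)\<close>, those of \<open>H\<^bsub>j+1\<^esub>\<close> have at \<open>0\<close> the orders \<open>2i\<close> and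
  \<open>2i + (2j + 1)\<close>. The reflection \<open>z \<mapsto> 2k - z\<close> exchanges the two sets and reverses their order, which
  is the compatibility relation.

  The substance lies in the identification of the points, which are given as local rings of integral
  closures of chart rings. Let \<open>\<nu>\<close> be a discrete valuation of \<open>F\<close> with \<open>\<nu>(f)\<close> odd, such as the order
  at \<open>0\<close> or minus the degree. Then \<open>a + b y \<mapsto> \<nu>(a\<^sup>2 - b\<^sup>2 f) = min (2 \<nu>(a)) (2 \<nu>(b) + \<nu>(f))\<close> is a
  normalized discrete valuation of \<open>K\<close>, because the two terms of the norm have different parity.
  Write \<open>V\<close> for its ring.

  Any point at which a uniformizer \<open>T\<close> of \<open>\<nu>\<close> vanishes equals \<open>V\<close> (\<open>point_unique\<close>): its local ring contains
  \<open>\<complex>[T]\<close> localized at \<open>T = 0\<close> and is closed under square roots, hence contains \<open>V\<close>, and a larger ring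
  would contain \<open>1 / T\<close>.

  Conversely \<open>V\<close> is a point (\<open>V_point\<close>). The integral closure of a suitable chart ring is described by
  inequalities for a family of valuations of \<open>F\<close> (\<open>integral_closure_A\<close>); it is therefore a ring, and
  \<open>V\<close> is its localization at the ideal of the functions that vanish. The inequalities hold for integral
  elements because the powers of such an element have bounded denominators
  (\<open>level_of_bounded_powers\<close>).
\<close>


section \<open>Discrete valuations of a field\<close>

locale field_valuation =
  fixes \<nu> :: "'a::field \<Rightarrow> int"
  assumes val_mult: "x \<noteq> 0 \<Longrightarrow> y \<noteq> 0 \<Longrightarrow> \<nu> (x * y) = \<nu> x + \<nu> y"
    and val_add: "x \<noteq> 0 \<Longrightarrow> y \<noteq> 0 \<Longrightarrow> x + y \<noteq> 0 \<Longrightarrow> min (\<nu> x) (\<nu> y) \<le> \<nu> (x + y)"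
begin

text \<open>
  The value \<open>\<nu> 0\<close> is an arbitrary integer; the separate clause for \<open>0\<close> plays the part of \<open>\<nu> 0 = \<infinity>\<close>.
\<close>

definition vball :: "int \<Rightarrow> 'a set" where
  "vball n = {x. x = 0 \<or> n \<le> \<nu> x}"

lemma val_1 [simp]: "\<nu> 1 = 0"
  using val_mult[of 1 1] by simp

lemma val_neg_1: "\<nu> (- 1) = 0"
  using val_mult[of "- 1" "- 1"] by simp

lemma val_minus [simp]: "\<nu> (- x) = \<nu> x"
  using val_mult[of "- 1" x] val_neg_1 by (cases "x = 0") auto

lemma val_divide: "x \<noteq> 0 \<Longrightarrow> y \<noteq> 0 \<Longrightarrow> \<nu> (x / y) = \<nu> x - \<nu> y"
  using val_mult[of "x / y" y] by simp

lemma val_power: "x \<noteq> 0 \<Longrightarrow> \<nu> (x ^ n) = int n * \<nu> x"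
  by (induction n) (auto simp: val_mult algebra_simps)

lemma vball_0 [simp]: "0 \<in> vball n"
  by (simp add: vball_def)

lemma vball_add: "x \<in> vball n \<Longrightarrow> y \<in> vball n \<Longrightarrow> x + y \<in> vball n"
  using val_add[of x y] by (cases "x = 0"; cases "y = 0"; cases "x + y = 0") (auto simp: vball_def)

lemma vball_minus: "x \<in> vball n \<Longrightarrow> - x \<in> vball n"
  by (auto simp: vball_def)

lemma vball_diff: "x \<in> vball n \<Longrightarrow> y \<in> vball n \<Longrightarrow> x - y \<in> vball n"
  using vball_add[of x n "- y"] vball_minus[of y n] by simp

lemma vball_mult: "x \<in> vball m \<Longrightarrow> y \<in> vball n \<Longrightarrow> x * y \<in> vball (m + n)"
  by (cases "x = 0"; cases "y = 0") (auto simp: vball_def val_mult)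

lemma vball_mono: "x \<in> vball m \<Longrightarrow> n \<le> m \<Longrightarrow> x \<in> vball n"
  by (auto simp: vball_def)

text \<open>
  If \<open>\<nu> (x + y)\<close> exceeded the minimum, the term of smaller value would be the difference of two elements
  of larger value.
\<close>

lemma val_add_distinct:
  assumes "x \<noteq> 0" "y \<noteq> 0" "\<nu> x \<noteq> \<nu> y"
  shows "x + y \<noteq> 0 \<and> \<nu> (x + y) = min (\<nu> x) (\<nu> y)"
proof -
  have ne: "x + y \<noteq> 0"
    using assms by (metis eq_neg_iff_add_eq_0 val_minus)
  then show ?thesis
    using assms val_add[of x y] val_add[of "x + y" "- x"] val_add[of "x + y" "- y"]
    by (auto simp: min_def split: if_splits)
qed

lemma vball_square: "x ^ 2 \<in> vball n \<longleftrightarrow> x = 0 \<or> n \<le> 2 * \<nu> x"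
  by (cases "x = 0") (auto simp: vball_def val_power)

lemma vball_square_mult: "c \<noteq> 0 \<Longrightarrow> x ^ 2 * c \<in> vball n \<longleftrightarrow> x = 0 \<or> n \<le> 2 * \<nu> x + \<nu> c"
  by (cases "x = 0") (auto simp: vball_def val_power val_mult)

text \<open>
  Squares enter because \<open>b y\<close> is seen from the base field through \<open>(b y)\<^sup>2 = b\<^sup>2 f\<close>. For \<open>c \<noteq> 0\<close> the condition
  is \<open>x = 0 \<or> n \<le> 2 * \<nu> x + \<nu> c\<close>, a lower bound for \<open>\<nu> x\<close>, and so passes to sums.
\<close>

lemma vball_square_mult_add:
  assumes "x ^ 2 * c \<in> vball n" "y ^ 2 * c \<in> vball n"
  shows "(x + y) ^ 2 * c \<in> vball n"
proof (cases "c = 0 \<or> x = 0 \<or> y = 0 \<or> x + y = 0")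
  case True
  then show ?thesis using assms by auto
next
  case False
  then show ?thesis
    using val_add[of x y] assms by (auto simp: vball_square_mult)
qed

text \<open>
  The values of the powers are the multiples of \<open>\<nu> x\<close>, which are unbounded below if \<open>\<nu> x < 0\<close>: a discrete
  valuation ring is completely integrally closed.
\<close>

lemma vball_of_bounded_powers:
  assumes "\<And>k. x ^ k \<in> vball C"
  shows "x \<in> vball 0"
proof (cases "x = 0")
  case False
  show ?thesis
  proof (rule ccontr)
    assume "x \<notin> vball 0"
    then have neg: "\<nu> x \<le> - 1" using False by (auto simp: vball_def)
    define k where "k = nat (\<bar>C\<bar> + 1)"
    have "C \<le> int k * \<nu> x"
      using assms[of k] False by (auto simp: vball_def val_power)
    also have "\<dots> \<le> int k * (- 1)"
      using neg by (intro mult_left_mono) auto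
    finally show False by (auto simp: k_def)
  qed
qed auto

end

locale ratfun_valuation = field_valuation \<nu> for \<nu> :: "ratfun \<Rightarrow> int" +
  assumes val_const: "c \<noteq> 0 \<Longrightarrow> \<nu> (to_fract [:c:]) = 0"
begin

lemma const_in_vball: "n \<le> 0 \<Longrightarrow> to_fract [:c:] \<in> vball n"
  by (cases "c = 0") (auto simp: vball_def val_const)

lemma vball_of_double:
  assumes "2 * x \<in> vball n"
  shows "x \<in> vball n"
proof -
  have "to_fract [:1 / 2 :: complex:] * (2 * x) \<in> vball (0 + n)"
    by (intro vball_mult const_in_vball assms) simp
  moreover have "to_fract [:1 / 2 :: complex:] * 2 = 1"
  proof -
    have "(2 :: ratfun) = to_fract [:2:]"
      by (metis (no_types) one_add_one one_pCons pCons_one to_fract_1 to_fract_add add_pCons add_0)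
    then show ?thesis
      by (simp only: to_fract_mult[symmetric]) (simp add: pCons_one)
  qed
  ultimately show ?thesis
    by (metis add_0 mult.assoc mult_1)
qed

end


section \<open>Order at a point and degree as valuations of \<open>\<complex>(x)\<close>\<close>

text \<open>
  The extension to \<open>\<complex>(x)\<close> by \<open>\<delta>(p / q) = \<delta>(p) - \<delta>(q)\<close> of a function on polynomials; the choice of the
  reduced quotient is harmless when \<open>\<delta>\<close> is additive on products (\<open>fract_ext_quot\<close>).
\<close>

definition fract_ext :: "(complex poly \<Rightarrow> int) \<Rightarrow> ratfun \<Rightarrow> int" where
  "fract_ext \<delta> z = \<delta> (fst (quot_of_fract z)) - \<delta> (snd (quot_of_fract z))"

lemma ratfun_cases:
  fixes z :: ratfun
  obtains p q where "z = to_fract p / to_fract q" "q \<noteq> 0" "coprime p q"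
  using coprime_quot_of_fract[of z] snd_quot_of_fract_nonzero[of z]
    Fract_quot_of_fract[of z] Fract_conv_to_fract by metis

lemma fract_ext_quot:
  assumes mult: "\<And>p q. p \<noteq> 0 \<Longrightarrow> q \<noteq> 0 \<Longrightarrow> \<delta> (p * q) = \<delta> p + \<delta> q"
    and "p \<noteq> 0" "q \<noteq> 0"
  shows "fract_ext \<delta> (to_fract p / to_fract q) = \<delta> p - \<delta> q"
proof -
  define z where "z = to_fract p / to_fract q"
  define r s where "r = fst (quot_of_fract z)" and "s = snd (quot_of_fract z)"
  have z0: "z \<noteq> 0" using assms by (simp add: z_def)
  have "r \<noteq> 0" "s \<noteq> 0" using z0 by (auto simp: r_def s_def)
  have "z = to_fract r / to_fract s"
    by (metis Fract_conv_to_fract Fract_quot_of_fract r_def s_def)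
  then have "to_fract (p * s) = to_fract (r * q)"
    using assms \<open>s \<noteq> 0\<close> by (simp add: z_def field_simps)
  then have "p * s = r * q" by (simp only: to_fract_eq_iff)
  then have "\<delta> p + \<delta> s = \<delta> r + \<delta> q"
    using mult[of p s] mult[of r q] assms \<open>r \<noteq> 0\<close> \<open>s \<noteq> 0\<close> by simp
  then show ?thesis
    by (simp add: fract_ext_def r_def s_def z_def)
qed

lemma fract_ext_valuation:
  assumes mult: "\<And>p q. p \<noteq> 0 \<Longrightarrow> q \<noteq> 0 \<Longrightarrow> \<delta> (p * q) = \<delta> p + \<delta> q"
    and add: "\<And>p q. p \<noteq> 0 \<Longrightarrow> q \<noteq> 0 \<Longrightarrow> p + q \<noteq> 0 \<Longrightarrow> min (\<delta> p) (\<delta> q) \<le> \<delta> (p + q)"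
    and const: "\<And>c. c \<noteq> 0 \<Longrightarrow> \<delta> [:c:] = 0"
  shows "ratfun_valuation (fract_ext \<delta>)"
proof
  note quot = fract_ext_quot[of \<delta>, OF mult]
  fix x y :: ratfun
  assume x: "x \<noteq> 0" and y: "y \<noteq> 0"
  obtain p q where pq: "x = to_fract p / to_fract q" "q \<noteq> 0"
    by (rule ratfun_cases)
  obtain r s where rs: "y = to_fract r / to_fract s" "s \<noteq> 0"
    by (rule ratfun_cases)
  have pr: "p \<noteq> 0" "r \<noteq> 0" using x y pq rs by auto
  have "x * y = to_fract (p * r) / to_fract (q * s)"
    by (simp add: pq rs)
  then show "fract_ext \<delta> (x * y) = fract_ext \<delta> x + fract_ext \<delta> y"
    using quot[of "p * r" "q * s"] quot[of p q] quot[of r s] pr pq rs mult by simp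
  assume "x + y \<noteq> 0"
  moreover have sum: "x + y = to_fract (p * s + r * q) / to_fract (q * s)"
    using pq rs by (simp add: field_simps)
  ultimately have "p * s + r * q \<noteq> 0" by force
  then show "min (fract_ext \<delta> x) (fract_ext \<delta> y) \<le> fract_ext \<delta> (x + y)"
    using add[of "p * s" "r * q"] sum quot[of "p * s + r * q" "q * s"] quot[of p q] quot[of r s]
      pr pq rs mult by simp
next
  fix c :: complex
  assume "c \<noteq> 0"
  then show "fract_ext \<delta> (to_fract [:c:]) = 0"
    using const[of c] const[of 1] by (simp add: fract_ext_def one_pCons)
qed

definition ord_pt :: "complex \<Rightarrow> ratfun \<Rightarrow> int" where
  "ord_pt c = fract_ext (\<lambda>p. int (Polynomial.order c p))"

definition ord_infty :: "ratfun \<Rightarrow> int" where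
  "ord_infty = fract_ext (\<lambda>p. - int (Polynomial.degree p))"

lemma order_add_ge:
  assumes "p \<noteq> 0" "q \<noteq> 0" "p + q \<noteq> (0 :: complex poly)"
  shows "min (Polynomial.order c p) (Polynomial.order c q) \<le> Polynomial.order c (p + q)"
proof -
  let ?n = "min (Polynomial.order c p) (Polynomial.order c q)"
  have "[:- c, 1:] ^ ?n dvd p" "[:- c, 1:] ^ ?n dvd q"
    using assms by (auto simp: order_divides)
  then have "[:- c, 1:] ^ ?n dvd p + q" by (rule dvd_add)
  then show ?thesis using assms by (simp add: order_divides)
qed

interpretation ord_pt: ratfun_valuation "ord_pt c"
  unfolding ord_pt_def
proof (rule fract_ext_valuation)
  fix p q :: "complex poly"
  assume "p \<noteq> 0" "q \<noteq> 0" "p + q \<noteq> 0"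
  then show "min (int (Polynomial.order c p)) (int (Polynomial.order c q)) \<le> int (Polynomial.order c (p + q))"
    using order_add_ge[of p q c] by linarith
qed (auto simp: order_mult order_0I)

interpretation ord_infty: ratfun_valuation ord_infty
  unfolding ord_infty_def
proof (rule fract_ext_valuation)
  fix p q :: "complex poly"
  assume "p \<noteq> 0" "q \<noteq> 0" "p + q \<noteq> 0"
  show "min (- int (Polynomial.degree p)) (- int (Polynomial.degree q)) \<le> - int (Polynomial.degree (p + q))"
    using degree_add_le_max[of p q] by linarith
qed (auto simp: degree_mult_eq)

lemma ord_pt_quot:
  "p \<noteq> 0 \<Longrightarrow> q \<noteq> 0 \<Longrightarrow>
    ord_pt c (to_fract p / to_fract q) = int (Polynomial.order c p) - int (Polynomial.order c q)"
  unfolding ord_pt_def by (rule fract_ext_quot) (auto simp: order_mult)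

lemma ord_infty_quot:
  "p \<noteq> 0 \<Longrightarrow> q \<noteq> 0 \<Longrightarrow>
    ord_infty (to_fract p / to_fract q) = int (Polynomial.degree q) - int (Polynomial.degree p)"
  unfolding ord_infty_def
  by (subst fract_ext_quot) (auto simp: degree_mult_eq)

lemma ord_pt_poly: "p \<noteq> 0 \<Longrightarrow> ord_pt c (to_fract p) = int (Polynomial.order c p)"
  using ord_pt_quot[of p 1 c] by simp

lemma ord_infty_poly: "p \<noteq> 0 \<Longrightarrow> ord_infty (to_fract p) = - int (Polynomial.degree p)"
  using ord_infty_quot[of p 1] by simp


section \<open>The field \<open>K = \<complex>(x)(\<surd>f)\<close>\<close>

lemma ff_simps [simp]:
  "carrier (function_field f) = UNIV"
  "\<one>\<^bsub>function_field f\<^esub> = (1, 0)"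
  "\<zero>\<^bsub>function_field f\<^esub> = (0, 0)"
  "(a, b) \<oplus>\<^bsub>function_field f\<^esub> (c, d) = (a + c, b + d)"
  "(a, b) \<otimes>\<^bsub>function_field f\<^esub> (c, d) = (a * c + b * d * to_fract f, a * d + b * c)"
  by (simp_all add: function_field_def)

lemma ff_mult_0 [simp]:
  "(0, 0) \<otimes>\<^bsub>function_field f\<^esub> h = (0, 0)"
  "h \<otimes>\<^bsub>function_field f\<^esub> (0, 0) = (0, 0)"
  by (cases h; simp)+

lemma ff_cring: "cring (function_field f)"
  apply (intro cringI abelian_groupI comm_monoidI)
  apply (clarsimp simp: algebra_simps)+
  apply (blast intro: add.right_inverse)
  apply (clarsimp simp: algebra_simps)+
  done

lemma to_fract_const_minus_1: "to_fract [:- 1 :: complex:] = - 1"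
proof -
  have "[:- 1 :: complex:] = - 1" by (simp add: one_pCons)
  then show ?thesis by (simp only: to_fract_uminus to_fract_1)
qed

lemma ff_minus [simp]: "\<ominus>\<^bsub>function_field f\<^esub> (a, b) = (- a, - b)"
proof -
  interpret cring "function_field f" by (rule ff_cring)
  show ?thesis using minus_equality[of "(- a, - b)" "(a, b)"] by simp
qed

lemma ff_pow_fst [simp]: "(a, 0) [^]\<^bsub>function_field f\<^esub> (n :: nat) = (a ^ n, 0)"
  by (induction n) (auto simp: mult.commute)

text \<open>
  The norm \<open>a\<^sup>2 - b\<^sup>2 f\<close> of \<open>a + b y\<close>. It is multiplicative, which makes multiplicativity of the extended
  valuation immediate.
\<close>

definition ff_norm :: "complex poly \<Rightarrow> ratfun \<times> ratfun \<Rightarrow> ratfun" where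
  "ff_norm f h = fst h ^ 2 - snd h ^ 2 * to_fract f"

lemma ff_norm_mult: "ff_norm f (h \<otimes>\<^bsub>function_field f\<^esub> h') = ff_norm f h * ff_norm f h'"
  by (cases h; cases h') (simp add: ff_norm_def power2_eq_square algebra_simps)

lemma ff_norm_0 [simp]: "ff_norm f (0, 0) = 0" and ff_norm_1 [simp]: "ff_norm f (1, 0) = 1"
  by (simp_all add: ff_norm_def)

lemma ff_norm_pow: "ff_norm f (h [^]\<^bsub>function_field f\<^esub> (n :: nat)) = ff_norm f h ^ n"
  by (induction n) (simp_all add: ff_norm_mult)


lemma ff_norm_inverse:
  assumes "ff_norm f (a, b) \<noteq> 0"
  shows "(a, b) \<otimes>\<^bsub>function_field f\<^esub> (a / ff_norm f (a, b), - b / ff_norm f (a, b)) = (1, 0)"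
proof -
  have "a * a - b * b * to_fract f = ff_norm f (a, b)"
    by (simp add: ff_norm_def power2_eq_square)
  then show ?thesis using assms by (simp add: field_simps)
qed

text \<open>
  The functions \<open>a + b y\<close> with \<open>n \<le> min (2 \<nu>(a)) (2 \<nu>(b) + \<nu>(f))\<close>. When \<open>\<nu>(f)\<close> is odd this minimum is a
  valuation of \<open>K\<close>. In general it is only submultiplicative, which is all that the computation of
  integral closures uses, so that split and unramified places are treated like the ramified ones.
\<close>

definition (in ratfun_valuation) level :: "complex poly \<Rightarrow> int \<Rightarrow> (ratfun \<times> ratfun) set" where
  "level f n = {h. fst h ^ 2 \<in> vball n \<and> snd h ^ 2 * to_fract f \<in> vball n}"

context ratfun_valuation
begin

lemma level_iff: "(a, b) \<in> level f n \<longleftrightarrow> a ^ 2 \<in> vball n \<and> b ^ 2 * to_fract f \<in> vball n"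
  by (simp add: level_def)

lemma level_0 [simp]: "(0, 0) \<in> level f n"
  by (simp add: level_iff)

lemma level_add: "h \<in> level f n \<Longrightarrow> h' \<in> level f n \<Longrightarrow> h \<oplus>\<^bsub>function_field f\<^esub> h' \<in> level f n"
  using vball_square_mult_add[of "fst h" 1 n "fst h'"] vball_square_mult_add[of "snd h" _ n "snd h'"]
  by (cases h; cases h') (simp add: level_iff)

lemma level_minus: "h \<in> level f n \<Longrightarrow> \<ominus>\<^bsub>function_field f\<^esub> h \<in> level f n"
  by (cases h) (simp add: level_iff)

lemma level_mult:
  assumes "h \<in> level f m" "h' \<in> level f n"
  shows "h \<otimes>\<^bsub>function_field f\<^esub> h' \<in> level f (m + n)"
proof -
  obtain a b c d where h: "h = (a, b)" "h' = (c, d)"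
    by (cases h; cases h')
  have 1: "a ^ 2 \<in> vball m" "b ^ 2 * to_fract f \<in> vball m"
    "c ^ 2 \<in> vball n" "d ^ 2 * to_fract f \<in> vball n"
    using assms by (auto simp: h level_iff)
  have "(a * c) ^ 2 * 1 \<in> vball (m + n)" "(b * d * to_fract f) ^ 2 * 1 \<in> vball (m + n)"
    "(a * d) ^ 2 * to_fract f \<in> vball (m + n)" "(b * c) ^ 2 * to_fract f \<in> vball (m + n)"
    using vball_mult[OF 1(1,3)] vball_mult[OF 1(2,4)] vball_mult[OF 1(1,4)] vball_mult[OF 1(2,3)]
    by (simp_all add: power2_eq_square mult_ac)
  then show ?thesis
    using vball_square_mult_add[of "a * c" 1] vball_square_mult_add[of "a * d"]
    by (simp add: h level_iff)
qed

lemma level_mono: "h \<in> level f m \<Longrightarrow> n \<le> m \<Longrightarrow> h \<in> level f n"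
  by (auto simp: level_def intro: vball_mono)

lemma level_norm: "h \<in> level f n \<Longrightarrow> ff_norm f h \<in> vball n"
  by (auto simp: level_def ff_norm_def intro: vball_diff)

lemma level_const: "n \<le> 0 \<Longrightarrow> const_fun c \<in> level f n"
  by (cases "c = 0") (simp_all add: const_fun_def level_iff vball_square val_const)

lemma level_1: "n \<le> 0 \<Longrightarrow> (1, 0) \<in> level f n"
  by (simp add: level_iff vball_def)

end


section \<open>The place of \<open>K\<close> over a ramified place of \<open>\<complex>(x)\<close>\<close>

text \<open>
  The equation for \<open>\<rho>\<close> says that \<open>\<rho> y\<close> will have value \<open>1\<close> in \<open>K\<close>; if \<open>\<nu>\<close> is normalized, such a \<open>\<rho>\<close> exists
  exactly when \<open>\<nu>(f)\<close> is odd.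
\<close>

locale ramified_valuation = ratfun_valuation \<nu> for \<nu> :: "ratfun \<Rightarrow> int" +
  fixes f :: "complex poly" and \<rho> :: ratfun
  assumes f_nonzero: "f \<noteq> 0" and \<rho>_nonzero: "\<rho> \<noteq> 0"
    and val_\<rho>: "2 * \<nu> \<rho> + \<nu> (to_fract f) = 1"
begin

abbreviation K :: "(ratfun \<times> ratfun) ring" where
  "K \<equiv> function_field f"

definition kval :: "ratfun \<times> ratfun \<Rightarrow> int" where
  "kval h = \<nu> (ff_norm f h)"

lemma odd_val_f: "odd (\<nu> (to_fract f))"
  using val_\<rho> by presburger

lemma to_fract_f_nonzero: "to_fract f \<noteq> 0"
  using f_nonzero by simp

text \<open>
  The values of \<open>a\<^sup>2\<close> and \<open>b\<^sup>2 f\<close> have different parity, so they cannot cancel in the norm.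
\<close>

lemma kval_formula:
  assumes "(a, b) \<noteq> (0, 0)"
  shows "ff_norm f (a, b) \<noteq> 0 \<and> kval (a, b) =
    (if b = 0 then 2 * \<nu> a else if a = 0 then 2 * \<nu> b + \<nu> (to_fract f)
     else min (2 * \<nu> a) (2 * \<nu> b + \<nu> (to_fract f)))"
proof (cases "a = 0 \<or> b = 0")
  case True
  then show ?thesis using assms f_nonzero
    by (auto simp: kval_def ff_norm_def val_power val_mult)
next
  case False
  have "\<nu> (a ^ 2) = 2 * \<nu> a" "\<nu> (- (b ^ 2 * to_fract f)) = 2 * \<nu> b + \<nu> (to_fract f)"
    using False f_nonzero by (simp_all add: val_power val_mult)
  moreover have "2 * \<nu> a \<noteq> 2 * \<nu> b + \<nu> (to_fract f)"
    using odd_val_f by presburger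
  ultimately show ?thesis
    using val_add_distinct[of "a ^ 2" "- (b ^ 2 * to_fract f)"] False f_nonzero
    by (simp add: kval_def ff_norm_def)
qed

lemma ff_norm_nonzero: "h \<noteq> (0, 0) \<Longrightarrow> ff_norm f h \<noteq> 0"
  using kval_formula by (cases h) blast

lemma level_kval: "h \<in> level f n \<longleftrightarrow> h = (0, 0) \<or> n \<le> kval h"
proof (cases h)
  case (Pair a b)
  then show ?thesis
    using kval_formula[of a b] f_nonzero
    by (cases "a = 0"; cases "b = 0") (auto simp: level_iff vball_square vball_square_mult)
qed

lemma K_field: "field K"
proof -
  have "\<exists>h' \<in> carrier K. h \<otimes>\<^bsub>K\<^esub> h' = \<one>\<^bsub>K\<^esub>" if "h \<noteq> \<zero>\<^bsub>K\<^esub>" for h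
  proof -
    obtain a b where h: "h = (a, b)" by (cases h)
    have "ff_norm f (a, b) \<noteq> 0" using that h ff_norm_nonzero[of h] by simp
    from ff_norm_inverse[OF this] show ?thesis unfolding h ff_simps(1-3) by blast
  qed
  moreover have "\<zero>\<^bsub>K\<^esub> \<noteq> \<one>\<^bsub>K\<^esub>" by simp
  ultimately show ?thesis by (intro cring.cring_fieldI2 ff_cring) auto
qed

lemma kval_mult: "h \<noteq> (0, 0) \<Longrightarrow> h' \<noteq> (0, 0) \<Longrightarrow> kval (h \<otimes>\<^bsub>K\<^esub> h') = kval h + kval h'"
  by (simp add: kval_def ff_norm_mult val_mult ff_norm_nonzero)

lemma K_mult_nonzero: "h \<noteq> (0, 0) \<Longrightarrow> h' \<noteq> (0, 0) \<Longrightarrow> h \<otimes>\<^bsub>K\<^esub> h' \<noteq> (0, 0)"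
  using ff_norm_mult[of f h h'] ff_norm_nonzero[of h] ff_norm_nonzero[of h'] by (metis ff_norm_0 no_zero_divisors)

lemma kval_1 [simp]: "kval (1, 0) = 0"
  by (simp add: kval_def)

lemma K_inv:
  assumes "h \<noteq> (0, 0)"
  shows "inv\<^bsub>K\<^esub> h \<noteq> (0, 0)" "h \<otimes>\<^bsub>K\<^esub> inv\<^bsub>K\<^esub> h = (1, 0)" "inv\<^bsub>K\<^esub> h \<otimes>\<^bsub>K\<^esub> h = (1, 0)"
    "kval (inv\<^bsub>K\<^esub> h) = - kval h"
proof -
  interpret field K by (rule K_field)
  have u: "h \<in> Units K" unfolding field_Units using assms by simp
  show 1: "h \<otimes>\<^bsub>K\<^esub> inv\<^bsub>K\<^esub> h = (1, 0)" "inv\<^bsub>K\<^esub> h \<otimes>\<^bsub>K\<^esub> h = (1, 0)"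
    using Units_r_inv[OF u] Units_l_inv[OF u] by simp_all
  show 2: "inv\<^bsub>K\<^esub> h \<noteq> (0, 0)"
    using 1(1) by (metis ff_mult_0(2) prod.inject zero_neq_one)
  show "kval (inv\<^bsub>K\<^esub> h) = - kval h"
    using kval_mult[OF assms 2] unfolding 1(1) kval_1 by simp
qed

lemma kval_nat_pow:
  assumes "h \<noteq> (0, 0)"
  shows "h [^]\<^bsub>K\<^esub> (n :: nat) \<noteq> (0, 0)" "kval (h [^]\<^bsub>K\<^esub> (n :: nat)) = int n * kval h"
proof -
  have "ff_norm f (h [^]\<^bsub>K\<^esub> n) \<noteq> 0"
    unfolding ff_norm_pow using ff_norm_nonzero[OF assms] by simp
  then show "h [^]\<^bsub>K\<^esub> n \<noteq> (0, 0)" by (metis ff_norm_0)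
  show "kval (h [^]\<^bsub>K\<^esub> n) = int n * kval h"
    unfolding kval_def ff_norm_pow using ff_norm_nonzero[OF assms] by (rule val_power)
qed

lemma kval_int_pow:
  assumes "h \<noteq> (0, 0)"
  shows "h [^]\<^bsub>K\<^esub> (n :: int) \<noteq> (0, 0)" "kval (h [^]\<^bsub>K\<^esub> (n :: int)) = n * kval h"
proof -
  show "h [^]\<^bsub>K\<^esub> n \<noteq> (0, 0)"
    unfolding int_pow_def2 using kval_nat_pow(1)[OF assms] K_inv(1) by metis
  show "kval (h [^]\<^bsub>K\<^esub> n) = n * kval h"
    unfolding int_pow_def2 using kval_nat_pow[OF assms]
    by (cases "n < 0") (simp_all only: if_True if_False K_inv(4) not_False_eq_True, simp_all)
qed

definition V :: "(ratfun \<times> ratfun) set" where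
  "V = level f 0"

lemma V_iff: "h \<in> V \<longleftrightarrow> h = (0, 0) \<or> 0 \<le> kval h"
  by (simp add: V_def level_kval)

lemma Units_V: "Units (K\<lparr>carrier := V\<rparr>) = {h. h \<noteq> (0, 0) \<and> kval h = 0}"
proof (intro equalityI subsetI)
  fix h assume "h \<in> Units (K\<lparr>carrier := V\<rparr>)"
  then obtain h' where h: "h \<in> V" "h' \<in> V" "h \<otimes>\<^bsub>K\<^esub> h' = (1, 0)"
    by (auto simp: Units_def)
  then have "h \<noteq> (0, 0)" "h' \<noteq> (0, 0)" by auto
  moreover have "kval h + kval h' = 0"
    using kval_mult[of h h'] h calculation by simp
  ultimately show "h \<in> {h. h \<noteq> (0, 0) \<and> kval h = 0}"
    using h by (auto simp: V_iff)
next
  fix h assume "h \<in> {h. h \<noteq> (0, 0) \<and> kval h = 0}"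
  then show "h \<in> Units (K\<lparr>carrier := V\<rparr>)"
    using K_inv[of h] by (auto simp: Units_def V_iff intro!: bexI[of _ "inv\<^bsub>K\<^esub> h"])
qed

lemma local_max_ideal_V: "local_max_ideal f V = level f 1"
  by (auto simp: local_max_ideal_def Units_V V_iff level_kval)

text \<open>
  An element of value \<open>1\<close> divides everything of positive value. Conversely a generator divides \<open>\<rho> y\<close>, so
  its value is at most \<open>1\<close>.
\<close>

lemma uniformizer_V: "uniformizer f V t \<longleftrightarrow> t \<noteq> (0, 0) \<and> kval t = 1"
proof
  assume u: "uniformizer f V t"
  define w where "w = (0 :: ratfun, \<rho>)"
  have w: "w \<noteq> (0, 0)" "kval w = 1"
    using kval_formula[of 0 \<rho>] \<rho>_nonzero val_\<rho> by (auto simp: w_def)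
  have gen: "level f 1 = {x \<otimes>\<^bsub>K\<^esub> t | x. x \<in> V}"
    using u by (simp add: uniformizer_def local_max_ideal_V cgenideal_def)
  obtain x where x: "x \<in> V" "w = x \<otimes>\<^bsub>K\<^esub> t"
    using gen w level_kval[of w 1] by auto
  have ne: "x \<noteq> (0, 0)" "t \<noteq> (0, 0)" using x w by auto
  have "kval t \<le> 1"
    using kval_mult[of x t] x ne w by (simp add: V_iff)
  moreover have "(1, 0) \<otimes>\<^bsub>K\<^esub> t \<in> level f 1"
    unfolding gen using V_iff[of "(1, 0)"] by fastforce
  then have "t \<in> level f 1" by (cases t) simp
  ultimately show "t \<noteq> (0, 0) \<and> kval t = 1"
    using ne by (auto simp: level_kval)
next
  assume t: "t \<noteq> (0, 0) \<and> kval t = 1"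
  interpret field K by (rule K_field)
  have "level f 1 = {x \<otimes>\<^bsub>K\<^esub> t | x. x \<in> V}"
  proof (intro equalityI subsetI)
    fix h assume h: "h \<in> level f 1"
    have "h = (h \<otimes>\<^bsub>K\<^esub> inv\<^bsub>K\<^esub> t) \<otimes>\<^bsub>K\<^esub> t"
      using K_inv[of t] t m_assoc[of h "inv\<^bsub>K\<^esub> t" t] r_one[of h] by simp
    moreover have "h \<otimes>\<^bsub>K\<^esub> inv\<^bsub>K\<^esub> t \<in> level f (1 + (- 1))"
      using K_inv[of t] t by (intro level_mult h) (simp add: level_kval)
    ultimately show "h \<in> {x \<otimes>\<^bsub>K\<^esub> t | x. x \<in> V}"
      unfolding V_def by (simp only: add.right_inverse) blast
  next
    fix h assume "h \<in> {x \<otimes>\<^bsub>K\<^esub> t | x. x \<in> V}"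
    then show "h \<in> level f 1"
      using level_mult[of _ f 0 t 1] t by (auto simp: V_def level_kval)
  qed
  then show "uniformizer f V t"
    using t by (simp add: uniformizer_def local_max_ideal_V cgenideal_def V_iff)
qed

lemma ord_at_V:
  assumes h: "h \<noteq> (0, 0)"
  shows "ord_at f V h = kval h"
  unfolding ord_at_def
proof (rule the_equality)
  interpret field K by (rule K_field)
  define w where "w = (0 :: ratfun, \<rho>)"
  have w: "w \<noteq> (0, 0)" "kval w = 1"
    using kval_formula[of 0 \<rho>] \<rho>_nonzero val_\<rho> by (auto simp: w_def)
  define p where "p = w [^]\<^bsub>K\<^esub> kval h"
  have p: "p \<noteq> (0, 0)" "kval p = kval h"
    using kval_int_pow[OF w(1), of "kval h"] w by (simp_all add: p_def)
  note q = K_inv[OF p(1)]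
  have "h = h \<otimes>\<^bsub>K\<^esub> inv\<^bsub>K\<^esub> p \<otimes>\<^bsub>K\<^esub> p"
    using q m_assoc[of h "inv\<^bsub>K\<^esub> p" p] r_one[of h] by simp
  moreover have "h \<otimes>\<^bsub>K\<^esub> inv\<^bsub>K\<^esub> p \<in> Units (K\<lparr>carrier := V\<rparr>)"
    using h q p kval_mult[of h "inv\<^bsub>K\<^esub> p"] K_mult_nonzero by (simp add: Units_V)
  ultimately show "\<exists>t. uniformizer f V t \<and>
      (\<exists>u \<in> Units (K\<lparr>carrier := V\<rparr>). h = u \<otimes>\<^bsub>K\<^esub> (t [^]\<^bsub>K\<^esub> kval h))"
    using w unfolding uniformizer_V p_def by blast
next
  fix n :: int
  assume "\<exists>t. uniformizer f V t \<and>
      (\<exists>u \<in> Units (K\<lparr>carrier := V\<rparr>). h = u \<otimes>\<^bsub>K\<^esub> (t [^]\<^bsub>K\<^esub> n))"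
  then obtain t u where "t \<noteq> (0, 0)" "kval t = 1" "u \<noteq> (0, 0)" "kval u = 0"
    and "h = u \<otimes>\<^bsub>K\<^esub> (t [^]\<^bsub>K\<^esub> n)"
    unfolding uniformizer_V Units_V by blast
  then show "n = kval h"
    using kval_int_pow[of t n] kval_mult[of u "t [^]\<^bsub>K\<^esub> n"] by simp
qed

end


section \<open>Integral closures\<close>

lemma chart_ring_subring: "subring (generate_ring (function_field f) G) (function_field f)"
proof -
  interpret cring "function_field f" by (rule ff_cring)
  show ?thesis by (rule generate_ring_is_subring) simp
qed

lemma eval_Nil [simp]: "ring.eval (function_field f) [] h = (0, 0)"
  and eval_Cons [simp]: "ring.eval (function_field f) (a # p) h =
    a \<otimes>\<^bsub>function_field f\<^esub> h [^]\<^bsub>function_field f\<^esub> length p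
      \<oplus>\<^bsub>function_field f\<^esub> ring.eval (function_field f) p h"
proof -
  interpret cring "function_field f" by (rule ff_cring)
  show "ring.eval (function_field f) [] h = (0, 0)" by simp
  show "ring.eval (function_field f) (a # p) h =
    a \<otimes>\<^bsub>function_field f\<^esub> h [^]\<^bsub>function_field f\<^esub> length p
      \<oplus>\<^bsub>function_field f\<^esub> ring.eval (function_field f) p h" by simp
qed

text \<open>
  The monic polynomial is split into its leading term and the list \<open>p\<close> of the other coefficients.
\<close>

lemma integral_closure_iff:
  assumes "subring A (function_field f)"
  shows "h \<in> integral_closure (function_field f) A \<longleftrightarrow>
    (\<exists>p. set p \<subseteq> A \<and> h [^]\<^bsub>function_field f\<^esub> length p
      \<oplus>\<^bsub>function_field f\<^esub> ring.eval (function_field f) p h = (0, 0))"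
proof -
  interpret cring "function_field f" by (rule ff_cring)
  have 1: "(1, 0) \<in> A" using subringE(3)[OF assms] by simp
  have one: "(1, 0) \<otimes>\<^bsub>function_field f\<^esub> u = u" for u
    using l_one[of u] by simp
  show ?thesis
  proof
    assume "h \<in> integral_closure (function_field f) A"
    then obtain q where q: "polynomial\<^bsub>function_field f\<^esub> A q" "q \<noteq> []" "hd q = (1, 0)"
      "ring.eval (function_field f) q h = (0, 0)"
      by (auto simp: integral_closure_def univ_poly_def)
    then obtain p where "q = (1, 0) # p" by (cases q) auto
    with q show "\<exists>p. set p \<subseteq> A \<and> h [^]\<^bsub>function_field f\<^esub> length p
      \<oplus>\<^bsub>function_field f\<^esub> ring.eval (function_field f) p h = (0, 0)"
      by (intro exI[of _ p]) (simp add: polynomial_def one)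
  next
    assume "\<exists>p. set p \<subseteq> A \<and> h [^]\<^bsub>function_field f\<^esub> length p
      \<oplus>\<^bsub>function_field f\<^esub> ring.eval (function_field f) p h = (0, 0)"
    then obtain p where "set p \<subseteq> A" "h [^]\<^bsub>function_field f\<^esub> length p
      \<oplus>\<^bsub>function_field f\<^esub> ring.eval (function_field f) p h = (0, 0)" by blast
    with 1 show "h \<in> integral_closure (function_field f) A"
      unfolding integral_closure_def univ_poly_def
      by (auto simp: polynomial_def one simp del: ring.eval.simps intro!: exI[of _ "(1, 0) # p"])
  qed
qed

lemma subset_integral_closure:
  assumes "subring A (function_field f)"
  shows "A \<subseteq> integral_closure (function_field f) A"
proof
  interpret cring "function_field f" by (rule ff_cring)
  fix a assume a: "a \<in> A"
  then have "\<ominus>\<^bsub>function_field f\<^esub> a \<in> A"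
    using subringE(5)[OF assms] by simp
  then show "a \<in> integral_closure (function_field f) A"
    unfolding integral_closure_iff[OF assms]
    by (intro exI[of _ "[\<ominus>\<^bsub>function_field f\<^esub> a]"]) (cases a, simp)
qed

text \<open>
  If \<open>p\<close> lists the coefficients below the leading one of a monic polynomial \<open>P(Z)\<close>, then \<open>spread p\<close> lists
  those of \<open>P(Z\<^sup>2)\<close>.
\<close>

fun spread :: "(ratfun \<times> ratfun) list \<Rightarrow> (ratfun \<times> ratfun) list" where
  "spread [] = []"
| "spread (a # p) = (0, 0) # a # spread p"

lemma length_spread [simp]: "length (spread p) = 2 * length p"
  by (induction p) auto

lemma set_spread: "set (spread p) \<subseteq> insert (0, 0) (set p)"
  by (induction p) auto

text \<open>
  Substituting \<open>Z\<^sup>2\<close> in a monic equation for \<open>h\<^sup>2\<close> gives one for \<open>h\<close>. For the present purposes this replaces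
  the transitivity of integral dependence.
\<close>

lemma integral_closure_sqrt:
  assumes A: "subring A (function_field f)"
    and h: "h \<otimes>\<^bsub>function_field f\<^esub> h \<in> integral_closure (function_field f) A"
  shows "h \<in> integral_closure (function_field f) A"
proof -
  let ?K = "function_field f"
  interpret cring ?K by (rule ff_cring)
  have pow: "(h \<otimes>\<^bsub>?K\<^esub> h) [^]\<^bsub>?K\<^esub> n = h [^]\<^bsub>?K\<^esub> (2 * n)" for n :: nat
    using nat_pow_mult[of h n n] pow_mult_distrib[of h h n] by (simp add: m_comm mult_2)
  have z: "(0, 0) \<oplus>\<^bsub>?K\<^esub> u = u" for u using l_zero[of u] by simp
  have eval: "ring.eval ?K (spread p) h = ring.eval ?K p (h \<otimes>\<^bsub>?K\<^esub> h)" for p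
    by (induction p) (simp_all add: pow z)
  obtain p where p: "set p \<subseteq> A"
    "(h \<otimes>\<^bsub>?K\<^esub> h) [^]\<^bsub>?K\<^esub> length p \<oplus>\<^bsub>?K\<^esub> ring.eval ?K p (h \<otimes>\<^bsub>?K\<^esub> h) = (0, 0)"
    using h integral_closure_iff[OF A] by blast
  then have "h [^]\<^bsub>?K\<^esub> length (spread p) \<oplus>\<^bsub>?K\<^esub> ring.eval ?K (spread p) h = (0, 0)"
    by (simp add: eval pow)
  moreover have "set (spread p) \<subseteq> A"
    using set_spread[of p] p subringE(2)[OF A] by auto
  ultimately show ?thesis
    using integral_closure_iff[OF A] by blast
qed

text \<open>
  The equation is \<open>Z\<^sup>2 - 2 a Z + (a\<^sup>2 - b\<^sup>2 f) = 0\<close>, the characteristic polynomial of \<open>a + b y\<close> over \<open>\<complex>(x)\<close>.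
\<close>

lemma integral_closure_quadratic:
  assumes A: "subring A (function_field f)"
    and "(- 2 * a, 0) \<in> A" "(ff_norm f (a, b), 0) \<in> A"
  shows "(a, b) \<in> integral_closure (function_field f) A"
  unfolding integral_closure_iff[OF A]
proof (intro exI conjI)
  show "set [(- 2 * a, 0), (ff_norm f (a, b), 0)] \<subseteq> A" using assms by simp
  have "(a, b) [^]\<^bsub>function_field f\<^esub> (2 :: nat) = (a, b) \<otimes>\<^bsub>function_field f\<^esub> (a, b)"
    "(a, b) [^]\<^bsub>function_field f\<^esub> (1 :: nat) = (a, b)"
    by (simp_all add: numeral_2_eq_2)
  then show "(a, b) [^]\<^bsub>function_field f\<^esub> length [(- 2 * a, 0), (ff_norm f (a, b), 0)]
     \<oplus>\<^bsub>function_field f\<^esub>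
     ring.eval (function_field f) [(- 2 * a, 0), (ff_norm f (a, b), 0)] (a, b) = (0, 0)"
    by (simp add: numeral_2_eq_2 ff_norm_def power2_eq_square algebra_simps)
qed

context ratfun_valuation
begin

lemma level_exists:
  assumes "f \<noteq> 0"
  shows "\<exists>n. h \<in> level f n"
proof -
  obtain a b where h: "h = (a, b)" by (cases h)
  have "h \<in> level f (min (\<nu> (a ^ 2)) (\<nu> (b ^ 2 * to_fract f)))"
    by (auto simp: h level_iff vball_def)
  then show ?thesis by blast
qed

lemma level_family_exists:
  assumes "f \<noteq> 0"
  shows "\<exists>C. \<forall>i < (n :: nat). h i \<in> level f C"
proof (induction n)
  case (Suc n)
  then obtain C where C: "\<forall>i < n. h i \<in> level f C" by blast
  obtain D where D: "h n \<in> level f D" using level_exists[OF assms] by blast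
  have "\<forall>i < Suc n. h i \<in> level f (min C D)"
    using C D by (auto simp: less_Suc_eq intro: level_mono)
  then show ?case by blast
qed auto

lemma level_eval_mult:
  assumes "set p \<subseteq> level f 0" "\<And>i. i < length p \<Longrightarrow> h [^]\<^bsub>function_field f\<^esub> (i + m) \<in> level f C"
  shows "ring.eval (function_field f) p h \<otimes>\<^bsub>function_field f\<^esub> h [^]\<^bsub>function_field f\<^esub> m \<in> level f C"
  using assms
proof (induction p)
  case (Cons a p)
  let ?K = "function_field f"
  interpret cring ?K by (rule ff_cring)
  have "a \<otimes>\<^bsub>?K\<^esub> h [^]\<^bsub>?K\<^esub> (length p + m) \<in> level f (0 + C)"
    using Cons.prems by (intro level_mult) auto
  moreover have "ring.eval ?K (a # p) h \<otimes>\<^bsub>?K\<^esub> h [^]\<^bsub>?K\<^esub> m =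
      a \<otimes>\<^bsub>?K\<^esub> h [^]\<^bsub>?K\<^esub> (length p + m) \<oplus>\<^bsub>?K\<^esub> ring.eval ?K p h \<otimes>\<^bsub>?K\<^esub> h [^]\<^bsub>?K\<^esub> m"
    using nat_pow_mult[of h "length p" m, symmetric] by (simp add: l_distr m_assoc del: eval.simps)
  ultimately show ?case using Cons by (simp add: level_add)
qed simp

lemma norm_in_vball:
  assumes "\<And>k :: nat. h [^]\<^bsub>function_field f\<^esub> k \<in> level f C"
  shows "ff_norm f h \<in> vball 0"
  using level_norm[OF assms] by (intro vball_of_bounded_powers[of _ C]) (simp add: ff_norm_pow)

text \<open>
  The norm of an element with bounded powers is integral, since it has bounded powers in \<open>\<complex>(x)\<close>. With
  \<open>h = a + b y\<close> also \<open>h + 1\<close> has bounded powers, and \<open>N(h + 1) - N(h) - 1 = 2 a\<close>; so \<open>a\<close> and then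
  \<open>b\<^sup>2 f = a\<^sup>2 - N(h)\<close> are integral.
\<close>

lemma level_of_bounded_powers:
  assumes bound: "\<And>k :: nat. h [^]\<^bsub>function_field f\<^esub> k \<in> level f C"
  shows "h \<in> level f 0"
proof -
  let ?K = "function_field f"
  interpret cring ?K by (rule ff_cring)
  obtain a b where h: "h = (a, b)" by (cases h)
  define h1 where "h1 = h \<oplus>\<^bsub>?K\<^esub> (1, 0)"
  \<comment> \<open>Mixed powers make the induction on \<open>k\<close> go through: one factor \<open>h + 1\<close> splits into two mixed powers.\<close>
  have mixed: "h [^]\<^bsub>?K\<^esub> i \<otimes>\<^bsub>?K\<^esub> h1 [^]\<^bsub>?K\<^esub> k \<in> level f C" for i k :: nat
  proof (induction k arbitrary: i)
    case 0
    then show ?case using bound[of i] r_one[of "h [^]\<^bsub>?K\<^esub> i"] by simp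
  next
    case (Suc k)
    have "h [^]\<^bsub>?K\<^esub> i \<otimes>\<^bsub>?K\<^esub> h1 [^]\<^bsub>?K\<^esub> Suc k =
        h [^]\<^bsub>?K\<^esub> i \<otimes>\<^bsub>?K\<^esub> h1 [^]\<^bsub>?K\<^esub> k \<otimes>\<^bsub>?K\<^esub> (h \<oplus>\<^bsub>?K\<^esub> \<one>\<^bsub>?K\<^esub>)"
      using m_assoc[of "h [^]\<^bsub>?K\<^esub> i" "h1 [^]\<^bsub>?K\<^esub> k" h1] by (simp add: h1_def)
    also have "\<dots> = h [^]\<^bsub>?K\<^esub> Suc i \<otimes>\<^bsub>?K\<^esub> h1 [^]\<^bsub>?K\<^esub> k \<oplus>\<^bsub>?K\<^esub> h [^]\<^bsub>?K\<^esub> i \<otimes>\<^bsub>?K\<^esub> h1 [^]\<^bsub>?K\<^esub> k"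
      using r_distr[of h "\<one>\<^bsub>?K\<^esub>" "h [^]\<^bsub>?K\<^esub> i \<otimes>\<^bsub>?K\<^esub> h1 [^]\<^bsub>?K\<^esub> k"]
        r_one[of "h [^]\<^bsub>?K\<^esub> i \<otimes>\<^bsub>?K\<^esub> h1 [^]\<^bsub>?K\<^esub> k"]
        m_assoc[of "h [^]\<^bsub>?K\<^esub> i" "h1 [^]\<^bsub>?K\<^esub> k" h] m_comm[of "h1 [^]\<^bsub>?K\<^esub> k" h]
        m_assoc[of "h [^]\<^bsub>?K\<^esub> i" h "h1 [^]\<^bsub>?K\<^esub> k"]
      by simp
    finally show ?case using level_add[OF Suc[of "Suc i"] Suc[of i]] by simp
  qed
  have "h1 [^]\<^bsub>?K\<^esub> k \<in> level f C" for k :: nat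
    using mixed[of 0 k] l_one[of "h1 [^]\<^bsub>?K\<^esub> k"] by simp
  then have N1: "ff_norm f h1 \<in> vball 0" by (rule norm_in_vball)
  have N: "ff_norm f h \<in> vball 0" by (rule norm_in_vball[OF bound])
  have "2 * a = ff_norm f h1 - ff_norm f h - 1"
    by (simp add: h h1_def ff_norm_def power2_eq_square algebra_simps)
  then have "2 * a \<in> vball 0"
    using N N1 by (auto intro!: vball_diff) (simp add: vball_def)
  then have "a \<in> vball 0" by (rule vball_of_double)
  then have "a ^ 2 \<in> vball 0" using vball_mult[of a 0 a 0] by (simp add: power2_eq_square)
  moreover have "b ^ 2 * to_fract f = a ^ 2 - ff_norm f h"
    by (simp add: h ff_norm_def)
  ultimately show ?thesis
    using N by (simp add: h level_iff vball_diff)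
qed

text \<open>
  The equation of degree \<open>n\<close> expresses every power of \<open>h\<close> through the \<open>n\<close> preceding ones with integral
  coefficients, so a lower bound for the first \<open>n\<close> powers holds for all of them.
\<close>

lemma integral_closure_level:
  assumes f: "f \<noteq> 0" and A: "subring A (function_field f)" "A \<subseteq> level f 0"
    and h: "h \<in> integral_closure (function_field f) A"
  shows "h \<in> level f 0"
proof -
  let ?K = "function_field f"
  interpret cring ?K by (rule ff_cring)
  obtain p where p: "set p \<subseteq> A" "h [^]\<^bsub>?K\<^esub> length p \<oplus>\<^bsub>?K\<^esub> ring.eval ?K p h = (0, 0)"
    using h integral_closure_iff[OF A(1)] by blast
  have top: "h [^]\<^bsub>?K\<^esub> length p = \<ominus>\<^bsub>?K\<^esub> ring.eval ?K p h"
    using p(2) minus_equality[of "h [^]\<^bsub>?K\<^esub> length p" "ring.eval ?K p h"] by simp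
  obtain C where C: "\<forall>i < length p. h [^]\<^bsub>?K\<^esub> i \<in> level f C"
    using level_family_exists[OF f] by blast
  have "h [^]\<^bsub>?K\<^esub> k \<in> level f C" for k :: nat
  proof (induction k rule: less_induct)
    case (less k)
    show ?case
    proof (cases "k < length p")
      case False
      have "h [^]\<^bsub>?K\<^esub> k = h [^]\<^bsub>?K\<^esub> length p \<otimes>\<^bsub>?K\<^esub> h [^]\<^bsub>?K\<^esub> (k - length p)"
        using False nat_pow_mult[of h "length p" "k - length p"] by simp
      also have "\<dots> = \<ominus>\<^bsub>?K\<^esub> (ring.eval ?K p h \<otimes>\<^bsub>?K\<^esub> h [^]\<^bsub>?K\<^esub> (k - length p))"
        unfolding top using l_minus[of "ring.eval ?K p h"] by simp
      finally show ?thesis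
        using level_minus[OF level_eval_mult[of p f h "k - length p" C]] less False p A by auto
    qed (use C in blast)
  qed
  then show ?thesis by (rule level_of_bounded_powers)
qed

end


section \<open>Points of the normalization\<close>

lemma ff_shuffle:
  "a \<otimes>\<^bsub>function_field f\<^esub> (b \<otimes>\<^bsub>function_field f\<^esub> c) =
    a \<otimes>\<^bsub>function_field f\<^esub> b \<otimes>\<^bsub>function_field f\<^esub> c"
  "a \<otimes>\<^bsub>function_field f\<^esub> (b \<otimes>\<^bsub>function_field f\<^esub> c) =
    a \<otimes>\<^bsub>function_field f\<^esub> c \<otimes>\<^bsub>function_field f\<^esub> b"
  "(a \<otimes>\<^bsub>function_field f\<^esub> b) \<otimes>\<^bsub>function_field f\<^esub> (c \<otimes>\<^bsub>function_field f\<^esub> d) =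
    (a \<otimes>\<^bsub>function_field f\<^esub> c) \<otimes>\<^bsub>function_field f\<^esub> (b \<otimes>\<^bsub>function_field f\<^esub> d)"
proof -
  interpret cring "function_field f" by (rule ff_cring)
  show "a \<otimes>\<^bsub>function_field f\<^esub> (b \<otimes>\<^bsub>function_field f\<^esub> c) =
    a \<otimes>\<^bsub>function_field f\<^esub> b \<otimes>\<^bsub>function_field f\<^esub> c"
   "a \<otimes>\<^bsub>function_field f\<^esub> (b \<otimes>\<^bsub>function_field f\<^esub> c) =
    a \<otimes>\<^bsub>function_field f\<^esub> c \<otimes>\<^bsub>function_field f\<^esub> b"
   "(a \<otimes>\<^bsub>function_field f\<^esub> b) \<otimes>\<^bsub>function_field f\<^esub> (c \<otimes>\<^bsub>function_field f\<^esub> d) =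
    (a \<otimes>\<^bsub>function_field f\<^esub> c) \<otimes>\<^bsub>function_field f\<^esub> (b \<otimes>\<^bsub>function_field f\<^esub> d)"
    by (simp_all add: m_ac)
qed

text \<open>
  A point of the normalization together with the data that present it: \<open>P\<close> is the localization at the
  maximal ideal \<open>M\<close> of the integral closure \<open>B\<close> of a chart ring \<open>A\<close>. That \<open>B\<close> is a ring is part of the
  assumption that \<open>M\<close> is a maximal ideal of it.
\<close>

locale normalization_point =
  fixes f :: "complex poly" and A B M P :: "(ratfun \<times> ratfun) set"
  assumes K_field: "field (function_field f)"
    and A: "A \<in> chart_rings f"
    and B: "B = integral_closure (function_field f) A"
    and M: "maximalideal M (function_field f\<lparr>carrier := B\<rparr>)"
    and P: "P = localization_at (function_field f) B M"
begin

abbreviation K :: "(ratfun \<times> ratfun) ring" where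
  "K \<equiv> function_field f"

lemma subring_A: "subring A K"
  using A chart_ring_subring by (auto simp: chart_rings_def)

lemma A_subset_B: "A \<subseteq> B"
  using subset_integral_closure[OF subring_A] by (simp add: B)

lemma const_in_A: "const_fun c \<in> A"
  using A by (auto simp: chart_rings_def intro: generate_ring.incl)

lemma cring_B: "cring (K\<lparr>carrier := B\<rparr>)"
proof -
  interpret M: maximalideal M "K\<lparr>carrier := B\<rparr>" by (rule M)
  interpret K: cring K by (rule ff_cring)
  have "x \<otimes>\<^bsub>K\<^esub> y = y \<otimes>\<^bsub>K\<^esub> x" for x y using K.m_comm[of x y] by simp
  then show ?thesis
    by (intro cring.intro M.ring_axioms comm_monoid.intro comm_monoid_axioms.intro)
      (auto simp: M.monoid_axioms)
qed

lemma B_closed: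
  "x \<in> B \<Longrightarrow> y \<in> B \<Longrightarrow> x \<oplus>\<^bsub>K\<^esub> y \<in> B"
  "x \<in> B \<Longrightarrow> y \<in> B \<Longrightarrow> x \<otimes>\<^bsub>K\<^esub> y \<in> B"
  "const_fun c \<in> B"
proof -
  interpret cring "K\<lparr>carrier := B\<rparr>" by (rule cring_B)
  show "x \<in> B \<Longrightarrow> y \<in> B \<Longrightarrow> x \<oplus>\<^bsub>K\<^esub> y \<in> B" "x \<in> B \<Longrightarrow> y \<in> B \<Longrightarrow> x \<otimes>\<^bsub>K\<^esub> y \<in> B"
    using a_closed[of x y] m_closed[of x y] by simp_all
  show "const_fun c \<in> B" using const_in_A A_subset_B by blast
qed

lemma M_facts:
  "M \<subseteq> B" "(0, 0) \<in> M" "(1, 0) \<notin> M"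
  "x \<in> M \<Longrightarrow> y \<in> M \<Longrightarrow> x \<oplus>\<^bsub>K\<^esub> y \<in> M"
  "x \<in> M \<Longrightarrow> y \<in> B \<Longrightarrow> x \<otimes>\<^bsub>K\<^esub> y \<in> M"
  "x \<in> B \<Longrightarrow> y \<in> B \<Longrightarrow> x \<otimes>\<^bsub>K\<^esub> y \<in> M \<Longrightarrow> x \<in> M \<or> y \<in> M"
proof -
  interpret M: maximalideal M "K\<lparr>carrier := B\<rparr>" by (rule M)
  interpret B: cring "K\<lparr>carrier := B\<rparr>" by (rule cring_B)
  interpret prime: primeideal M "K\<lparr>carrier := B\<rparr>" by (rule B.maximalideal_prime[OF M])
  show "M \<subseteq> B" using M.a_subset by simp
  show "(0, 0) \<in> M" using additive_subgroup.zero_closed[OF M.additive_subgroup_axioms] by simp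
  show "(1, 0) \<notin> M" using M.one_imp_carrier M.I_notcarr by auto
  show "x \<in> M \<Longrightarrow> y \<in> M \<Longrightarrow> x \<oplus>\<^bsub>K\<^esub> y \<in> M" using additive_subgroup.a_closed[OF M.additive_subgroup_axioms, of x y] by simp
  show "x \<in> M \<Longrightarrow> y \<in> B \<Longrightarrow> x \<otimes>\<^bsub>K\<^esub> y \<in> M" using M.I_r_closed[of x y] by simp
  show "x \<in> B \<Longrightarrow> y \<in> B \<Longrightarrow> x \<otimes>\<^bsub>K\<^esub> y \<in> M \<Longrightarrow> x \<in> M \<or> y \<in> M"
    using prime.I_prime[of x y] by simp
qed

lemma P_iff: "h \<in> P \<longleftrightarrow> (\<exists>s \<in> B - M. h \<otimes>\<^bsub>K\<^esub> s \<in> B)"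
proof -
  interpret field K by (rule K_field)
  have cancel: "h \<otimes>\<^bsub>K\<^esub> s \<otimes>\<^bsub>K\<^esub> inv\<^bsub>K\<^esub> s = h" "h \<otimes>\<^bsub>K\<^esub> inv\<^bsub>K\<^esub> s \<otimes>\<^bsub>K\<^esub> s = h"
    if "s \<in> B - M" for h s
  proof -
    have "s \<noteq> \<zero>\<^bsub>K\<^esub>" using that M_facts(2) unfolding ff_simps(3) by blast
    then have u: "s \<in> Units K" unfolding field_Units by simp
    have one: "h \<otimes>\<^bsub>K\<^esub> \<one>\<^bsub>K\<^esub> = h" by (rule r_one) simp
    show "h \<otimes>\<^bsub>K\<^esub> s \<otimes>\<^bsub>K\<^esub> inv\<^bsub>K\<^esub> s = h" "h \<otimes>\<^bsub>K\<^esub> inv\<^bsub>K\<^esub> s \<otimes>\<^bsub>K\<^esub> s = h"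
      unfolding ff_shuffle(1)[symmetric] Units_l_inv[OF u] Units_r_inv[OF u] by (rule one)+
  qed
  show ?thesis
  proof
    assume "h \<in> P"
    then obtain a s where "h = a \<otimes>\<^bsub>K\<^esub> inv\<^bsub>K\<^esub> s" "a \<in> B" "s \<in> B - M"
      unfolding P localization_at_def by blast
    then show "\<exists>s \<in> B - M. h \<otimes>\<^bsub>K\<^esub> s \<in> B" using cancel(2) by metis
  next
    assume "\<exists>s \<in> B - M. h \<otimes>\<^bsub>K\<^esub> s \<in> B"
    then obtain s where s: "s \<in> B - M" "h \<otimes>\<^bsub>K\<^esub> s \<in> B" by blast
    then have "h = (h \<otimes>\<^bsub>K\<^esub> s) \<otimes>\<^bsub>K\<^esub> inv\<^bsub>K\<^esub> s" by (simp only: cancel(1))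
    then show "h \<in> P" unfolding P localization_at_def using s by blast
  qed
qed

lemma P_inverse:
  assumes "h \<in> B - M" "u \<otimes>\<^bsub>K\<^esub> h \<in> B"
  shows "u \<in> P"
  using assms P_iff by blast

lemma B_subset_P: "B \<subseteq> P"
proof
  fix h assume "h \<in> B"
  moreover have "(1, 0) \<in> B - M" using B_closed(3)[of 1] M_facts(3) by (simp add: const_fun_def pCons_one)
  ultimately show "h \<in> P" unfolding P_iff using B_closed(2) by blast
qed

lemma P_const: "const_fun c \<in> P"
  using B_closed(3) B_subset_P by blast

lemma complement_mult: "s \<in> B - M \<Longrightarrow> t \<in> B - M \<Longrightarrow> s \<otimes>\<^bsub>K\<^esub> t \<in> B - M"
  using M_facts(6) B_closed(2) by blast

lemma P_add:
  assumes "h \<in> P" "h' \<in> P"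
  shows "h \<oplus>\<^bsub>K\<^esub> h' \<in> P"
proof -
  interpret cring K by (rule ff_cring)
  obtain s t where st: "s \<in> B - M" "h \<otimes>\<^bsub>K\<^esub> s \<in> B" "t \<in> B - M" "h' \<otimes>\<^bsub>K\<^esub> t \<in> B"
    using assms P_iff by blast
  have "(h \<oplus>\<^bsub>K\<^esub> h') \<otimes>\<^bsub>K\<^esub> (s \<otimes>\<^bsub>K\<^esub> t) = h \<otimes>\<^bsub>K\<^esub> s \<otimes>\<^bsub>K\<^esub> t \<oplus>\<^bsub>K\<^esub> h' \<otimes>\<^bsub>K\<^esub> t \<otimes>\<^bsub>K\<^esub> s"
    unfolding ff_shuffle(1)[of f h s t, symmetric] ff_shuffle(2)[of f h' s t, symmetric]
    by (rule l_distr) simp_all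
  then have "(h \<oplus>\<^bsub>K\<^esub> h') \<otimes>\<^bsub>K\<^esub> (s \<otimes>\<^bsub>K\<^esub> t) \<in> B"
    using st B_closed(1)[OF B_closed(2) B_closed(2)] by (metis DiffD1)
  then show ?thesis using P_inverse complement_mult[of s t] st by blast
qed

lemma P_mult:
  assumes "h \<in> P" "h' \<in> P"
  shows "h \<otimes>\<^bsub>K\<^esub> h' \<in> P"
proof -
  obtain s t where st: "s \<in> B - M" "h \<otimes>\<^bsub>K\<^esub> s \<in> B" "t \<in> B - M" "h' \<otimes>\<^bsub>K\<^esub> t \<in> B"
    using assms P_iff by blast
  have "(h \<otimes>\<^bsub>K\<^esub> h') \<otimes>\<^bsub>K\<^esub> (s \<otimes>\<^bsub>K\<^esub> t) = (h \<otimes>\<^bsub>K\<^esub> s) \<otimes>\<^bsub>K\<^esub> (h' \<otimes>\<^bsub>K\<^esub> t)"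
    by (rule ff_shuffle(3))
  then have "(h \<otimes>\<^bsub>K\<^esub> h') \<otimes>\<^bsub>K\<^esub> (s \<otimes>\<^bsub>K\<^esub> t) \<in> B"
    using st B_closed(2) by metis
  then show ?thesis using P_inverse complement_mult[of s t] st by blast
qed

text \<open>
  If \<open>h\<^sup>2 s\<close> lies in \<open>B\<close> then so does \<open>(h s)\<^sup>2\<close>, and \<open>B\<close> is closed under square roots. Integral closedness
  of \<open>P\<close> enters below only in this form.
\<close>

lemma P_sqrt:
  assumes "h \<otimes>\<^bsub>K\<^esub> h \<in> P"
  shows "h \<in> P"
proof -
  obtain s where s: "s \<in> B - M" "h \<otimes>\<^bsub>K\<^esub> h \<otimes>\<^bsub>K\<^esub> s \<in> B"
    using assms P_iff by blast
  have "(h \<otimes>\<^bsub>K\<^esub> s) \<otimes>\<^bsub>K\<^esub> (h \<otimes>\<^bsub>K\<^esub> s) = h \<otimes>\<^bsub>K\<^esub> h \<otimes>\<^bsub>K\<^esub> s \<otimes>\<^bsub>K\<^esub> s"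
    unfolding ff_shuffle(3)[of f h s h s] by (rule ff_shuffle(1))
  then have "(h \<otimes>\<^bsub>K\<^esub> s) \<otimes>\<^bsub>K\<^esub> (h \<otimes>\<^bsub>K\<^esub> s) \<in> B"
    using s B_closed(2) by (metis DiffD1)
  then have "h \<otimes>\<^bsub>K\<^esub> s \<in> B"
    unfolding B by (rule integral_closure_sqrt[OF subring_A])
  then show ?thesis using P_inverse s by blast
qed

text \<open>
  A nonunit \<open>T\<close> is a quotient with numerator in \<open>M\<close>, and adding an element of \<open>M\<close> does not move a
  numerator into \<open>M\<close>.
\<close>

lemma P_local:
  assumes T: "T \<in> local_max_ideal f P" and r: "r \<in> P" and c: "c \<noteq> 0"
  shows "\<exists>u \<in> P. u \<otimes>\<^bsub>K\<^esub> (const_fun c \<oplus>\<^bsub>K\<^esub> T \<otimes>\<^bsub>K\<^esub> r) = (1, 0)"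
proof -
  interpret field K by (rule K_field)
  have TP: "T \<in> P" using T by (simp add: local_max_ideal_def)
  obtain s t where s: "s \<in> B - M" "T \<otimes>\<^bsub>K\<^esub> s \<in> B" and t: "t \<in> B - M" "r \<otimes>\<^bsub>K\<^esub> t \<in> B"
    using TP r P_iff by blast
  have TM: "T \<otimes>\<^bsub>K\<^esub> s \<in> M"
  proof (rule ccontr)
    assume n: "T \<otimes>\<^bsub>K\<^esub> s \<notin> M"
    then have "T \<noteq> \<zero>\<^bsub>K\<^esub>" using M_facts(2) by auto
    then have u: "T \<in> Units K" unfolding field_Units by simp
    have "inv\<^bsub>K\<^esub> T \<otimes>\<^bsub>K\<^esub> (T \<otimes>\<^bsub>K\<^esub> s) = s"
      using m_assoc[of "inv\<^bsub>K\<^esub> T" T s] Units_l_inv[OF u] l_one[of s] by (simp del: ff_simps(2))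
    then have "inv\<^bsub>K\<^esub> T \<in> P" using P_inverse[of "T \<otimes>\<^bsub>K\<^esub> s" "inv\<^bsub>K\<^esub> T"] n s by simp
    then have "T \<in> Units (K\<lparr>carrier := P\<rparr>)"
      using Units_l_inv[OF u] Units_r_inv[OF u] TP unfolding Units_def
      by (simp del: ff_simps(2)) (simp, blast)
    then show False using T by (simp add: local_max_ideal_def)
  qed
  define e where "e = const_fun c \<oplus>\<^bsub>K\<^esub> T \<otimes>\<^bsub>K\<^esub> r"
  define st where "st = s \<otimes>\<^bsub>K\<^esub> t"
  have st: "st \<in> B - M" using complement_mult s t by (simp add: st_def)
  define m where "m = (T \<otimes>\<^bsub>K\<^esub> s) \<otimes>\<^bsub>K\<^esub> (r \<otimes>\<^bsub>K\<^esub> t)"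
  have m: "m \<in> M" unfolding m_def using M_facts(5) TM t by blast
  have est: "e \<otimes>\<^bsub>K\<^esub> st = const_fun c \<otimes>\<^bsub>K\<^esub> st \<oplus>\<^bsub>K\<^esub> m"
    using l_distr[of "const_fun c" "T \<otimes>\<^bsub>K\<^esub> r" "s \<otimes>\<^bsub>K\<^esub> t"] ff_shuffle(3)[of f T s r t]
    unfolding e_def m_def st_def by simp
  have estB: "e \<otimes>\<^bsub>K\<^esub> st \<in> B"
    unfolding est using st m M_facts(1) B_closed by blast
  have estM: "e \<otimes>\<^bsub>K\<^esub> st \<notin> M"
  proof
    assume "e \<otimes>\<^bsub>K\<^esub> st \<in> M"
    then have "e \<otimes>\<^bsub>K\<^esub> st \<oplus>\<^bsub>K\<^esub> m \<otimes>\<^bsub>K\<^esub> const_fun (- 1) \<in> M"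
      using M_facts(4,5) m B_closed(3) by blast
    moreover have "e \<otimes>\<^bsub>K\<^esub> st \<oplus>\<^bsub>K\<^esub> m \<otimes>\<^bsub>K\<^esub> const_fun (- 1) = const_fun c \<otimes>\<^bsub>K\<^esub> st"
      unfolding est by (cases m; cases st) (simp add: const_fun_def to_fract_const_minus_1)
    ultimately have "const_fun c \<otimes>\<^bsub>K\<^esub> st \<otimes>\<^bsub>K\<^esub> const_fun (1 / c) \<in> M"
      using M_facts(5) B_closed(3) by simp
    moreover have "const_fun c \<otimes>\<^bsub>K\<^esub> st \<otimes>\<^bsub>K\<^esub> const_fun (1 / c) = st"
    proof -
      have "to_fract [:c:] * to_fract [:1 / c:] = 1"
        using c by (simp only: to_fract_mult[symmetric]) (simp add: pCons_one)
      then show ?thesis by (cases st) (simp add: const_fun_def mult_ac)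
    qed
    ultimately show False using st by simp
  qed
  have e0: "e \<noteq> \<zero>\<^bsub>K\<^esub>" using estM M_facts(2) by auto
  then have u: "e \<in> Units K" unfolding field_Units by simp
  have "inv\<^bsub>K\<^esub> e \<otimes>\<^bsub>K\<^esub> (e \<otimes>\<^bsub>K\<^esub> st) = st"
    using m_assoc[of "inv\<^bsub>K\<^esub> e" e st] Units_l_inv[OF u] l_one[of st] by (simp del: ff_simps(2))
  then have "inv\<^bsub>K\<^esub> e \<in> P" using P_inverse[of "e \<otimes>\<^bsub>K\<^esub> st" "inv\<^bsub>K\<^esub> e"] estB estM st by simp
  moreover have "inv\<^bsub>K\<^esub> e \<otimes>\<^bsub>K\<^esub> e = (1, 0)" using Units_l_inv[OF u] unfolding ff_simps(2) .
  ultimately show ?thesis unfolding e_def[symmetric] by blast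
qed

end

lemma normalization_pointE:
  assumes "P \<in> normalization_points f" "field (function_field f)"
  obtains A B M where "normalization_point f A B M P"
  using assms by (auto simp: normalization_points_def normalization_point_def)


section \<open>Uniqueness of the point over a ramified place\<close>

text \<open>
  The value \<open>p(T)\<close> of a polynomial with constant coefficients at a rational function.
\<close>

definition ev :: "ratfun \<Rightarrow> complex poly \<Rightarrow> ratfun" where
  "ev T p = poly (map_poly (\<lambda>c. to_fract [:c:]) p) T"

lemma ev_0 [simp]: "ev T 0 = 0"
  by (simp add: ev_def)

lemma ev_pCons [simp]: "ev T (pCons c p) = to_fract [:c:] + T * ev T p"
  by (simp add: ev_def map_poly_pCons)

lemma ev_closed:
  assumes "\<And>h h'. h \<in> D \<Longrightarrow> h' \<in> D \<Longrightarrow> h \<oplus>\<^bsub>function_field f\<^esub> h' \<in> D"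
    and "\<And>h h'. h \<in> D \<Longrightarrow> h' \<in> D \<Longrightarrow> h \<otimes>\<^bsub>function_field f\<^esub> h' \<in> D"
    and "\<And>c. const_fun c \<in> D" "(T, 0) \<in> D"
  shows "(ev T p, 0) \<in> D"
proof (induction p)
  case 0
  then show ?case using assms(3)[of 0] by (simp add: const_fun_def)
next
  case (pCons c p)
  then show ?case
    using assms(1)[OF assms(3)[of c] assms(2)[OF assms(4) pCons.IH]] by (simp add: const_fun_def)
qed

lemma (in ratfun_valuation) ev_in_vball: "T \<in> vball 0 \<Longrightarrow> ev T p \<in> vball 0"
proof (induction p)
  case (pCons c p)
  then show ?case
    using vball_mult[of T 0 "ev T p" 0] by (auto intro!: vball_add const_in_vball)
qed simp

text \<open>
  The last assumption says that the valuation ring of \<open>\<nu>\<close> is \<open>\<complex>[T]\<close> localized at \<open>T = 0\<close>; in particular its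
  residue field is \<open>\<complex>\<close>. It lets the places \<open>0\<close> (\<open>T = x\<close>) and \<open>\<infinity>\<close> (\<open>T = 1 / x\<close>) be treated alike.
\<close>

locale ramified_place = ramified_valuation \<nu> f \<rho> for \<nu> f \<rho> +
  fixes T :: ratfun
  assumes T_nonzero: "T \<noteq> 0" and val_T: "\<nu> T = 1"
    and vball_ev: "z \<in> vball 0 \<Longrightarrow> \<exists>p q. poly q 0 \<noteq> 0 \<and> z = ev T p / ev T q"
begin

lemma T_in_vball: "T \<in> vball 0"
  by (simp add: vball_def val_T)

lemma ev_unit:
  assumes "poly q 0 \<noteq> 0"
  shows "ev T q \<noteq> 0 \<and> \<nu> (ev T q) = 0"
proof -
  obtain c r where q: "q = pCons c r" by (cases q)
  have c: "c \<noteq> 0" using assms q by simp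
  have c': "to_fract [:c:] \<noteq> 0" "\<nu> (to_fract [:c:]) = 0" using c by (simp_all add: val_const)
  have r: "ev T r \<in> vball 0" by (rule ev_in_vball[OF T_in_vball])
  show ?thesis
  proof (cases "ev T r = 0")
    case True
    then show ?thesis using c' by (simp add: q)
  next
    case False
    then have "T * ev T r \<noteq> 0" "\<nu> (T * ev T r) \<ge> 1"
      using r T_nonzero val_T by (auto simp: val_mult vball_def)
    then show ?thesis
      using val_add_distinct[of "to_fract [:c:]" "T * ev T r"] c' by (simp add: q)
  qed
qed

lemma residue:
  assumes "z \<in> vball 0"
  shows "\<exists>c. z - to_fract [:c:] \<in> vball 1"
proof -
  obtain p q where pq: "poly q 0 \<noteq> 0" "z = ev T p / ev T q" using vball_ev[OF assms] by blast
  obtain a r where p: "p = pCons a r" by (cases p)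
  obtain b s where q: "q = pCons b s" by (cases q)
  have b: "b \<noteq> 0" using pq q by simp
  define c where "c = a / b"
  have cb: "to_fract [:a:] = to_fract [:c:] * to_fract [:b:]"
    using b by (simp only: to_fract_mult[symmetric]) (simp add: c_def)
  have "z - to_fract [:c:] = T * (ev T r - to_fract [:c:] * ev T s) * (1 / ev T q)"
    using ev_unit[OF pq(1)] by (simp add: pq(2) p q cb field_simps)
  moreover have "1 / ev T q \<in> vball 0"
    using ev_unit[OF pq(1)] by (simp add: vball_def val_divide)
  moreover have "ev T r - to_fract [:c:] * ev T s \<in> vball 0"
    using vball_mult[OF const_in_vball[of 0 c] ev_in_vball[OF T_in_vball, of s]]
    by (auto intro!: vball_diff ev_in_vball[OF T_in_vball])
  moreover have "T \<in> vball 1" by (simp add: vball_def val_T)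
  ultimately show ?thesis
    using vball_mult[of "T * (ev T r - to_fract [:c:] * ev T s)" 1 "1 / ev T q" 0]
      vball_mult[of T 1 "ev T r - to_fract [:c:] * ev T s" 0] by (intro exI[of _ c]) simp
qed

text \<open>
  A point \<open>P\<close> at which \<open>T\<close> vanishes contains the valuation ring of \<open>\<nu>\<close>, as the polynomials in \<open>T\<close> with
  nonzero constant term are invertible in \<open>P\<close>. For \<open>a + b y\<close> in \<open>V\<close> both \<open>a\<^sup>2\<close> and \<open>(b y)\<^sup>2\<close> lie in that ring,
  hence \<open>a\<close> and \<open>b y\<close> lie in \<open>P\<close>, and \<open>V \<subseteq> P\<close>. Equality holds because \<open>V\<close> is a discrete valuation ring: an
  element of negative value would put \<open>1 / T\<close> into \<open>P\<close>.
\<close>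

lemma point_unique:
  assumes P: "P \<in> normalization_points f" and T: "(T, 0) \<in> local_max_ideal f P"
  shows "P = V"
proof -
  obtain A B M where "normalization_point f A B M P"
    using normalization_pointE[OF P K_field] by blast
  then interpret P: normalization_point f A B M P .
  have TP: "(T, 0) \<in> P" using T by (simp add: local_max_ideal_def)
  have ev: "(ev T p, 0) \<in> P" for p
    by (rule ev_closed[OF P.P_add P.P_mult P.P_const TP])
  have base: "(z, 0) \<in> P" if z: "z \<in> vball 0" for z
  proof -
    obtain p q where pq: "poly q 0 \<noteq> 0" "z = ev T p / ev T q" using vball_ev[OF z] by blast
    obtain c r where q: "q = pCons c r" by (cases q)
    then obtain u where u: "u \<in> P" "u \<otimes>\<^bsub>K\<^esub> (const_fun c \<oplus>\<^bsub>K\<^esub> (T, 0) \<otimes>\<^bsub>K\<^esub> (ev T r, 0)) = (1, 0)"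
      using P.P_local[OF T ev[of r], of c] pq(1) by auto
    obtain u1 u2 where u12: "u = (u1, u2)" by (cases u)
    have "u1 * ev T q = 1" "u2 * ev T q = 0"
      using u(2) by (simp_all add: u12 q const_fun_def)
    then have "u = (1 / ev T q, 0)"
      using u12 by (auto simp: eq_divide_eq)
    then show ?thesis
      using P.P_mult[OF ev[of p] u(1)] pq(2) by simp
  qed
  have VP: "V \<subseteq> P"
  proof
    fix h assume h: "h \<in> V"
    obtain a b where ab: "h = (a, b)" by (cases h)
    have "a ^ 2 \<in> vball 0" "b ^ 2 * to_fract f \<in> vball 0"
      using h by (simp_all add: ab V_def level_iff)
    then have "(a ^ 2, 0) \<in> P" "(b ^ 2 * to_fract f, 0) \<in> P" by (auto intro: base)
    then have "(a, 0) \<in> P" "(0, b) \<in> P"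
      using P.P_sqrt[of "(a, 0)"] P.P_sqrt[of "(0, b)"] by (simp_all add: power2_eq_square)
    then show "h \<in> P" using P.P_add[of "(a, 0)" "(0, b)"] by (simp add: ab)
  qed
  moreover have "P \<subseteq> V"
  proof (rule subsetI, rule ccontr)
    fix h assume h: "h \<in> P" "h \<notin> V"
    then have h0: "h \<noteq> (0, 0)" "kval h < 0" by (auto simp: V_iff)
    \<comment> \<open>This exponent makes \<open>h\<^sup>2 T\<^sup>n\<close> have value \<open>-2\<close>, the value of \<open>1 / T\<close>.\<close>
    define n where "n = nat (- kval h - 1)"
    define g where "g = (h \<otimes>\<^bsub>K\<^esub> h) \<otimes>\<^bsub>K\<^esub> (T ^ n, 0)"
    have kT: "kval (T ^ m, 0) = 2 * int m" for m
      using kval_formula[of "T ^ m" 0] T_nonzero by (simp add: val_power val_T)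
    have hh: "h \<otimes>\<^bsub>K\<^esub> h \<noteq> (0, 0)" using h0 K_mult_nonzero by blast
    have g: "g \<noteq> (0, 0)" "kval g = - 2"
      using K_mult_nonzero[OF hh, of "(T ^ n, 0)"] kval_mult[OF hh, of "(T ^ n, 0)"]
        kval_mult[OF h0(1) h0(1)] kT[of n] h0(2) T_nonzero
      by (simp_all add: g_def n_def)
    have "T ^ n \<in> vball 0" by (simp add: vball_def val_power val_T T_nonzero)
    then have gP: "g \<in> P" unfolding g_def using P.P_mult base h(1) by blast
    define u where "u = inv\<^bsub>K\<^esub> g \<otimes>\<^bsub>K\<^esub> (1 / T, 0)"
    have T': "(1 / T, 0) \<noteq> (0 :: ratfun, 0 :: ratfun)" "kval (1 / T, 0) = - 2"
      using kval_formula[of "1 / T" 0] T_nonzero val_divide[of 1 T] val_T by simp_all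
    have "kval u = 0"
      unfolding u_def using kval_mult[OF K_inv(1)[OF g(1)] T'(1)] K_inv(4)[OF g(1)] g(2) T'(2) by simp
    then have uP: "u \<in> P" using VP V_iff[of u] by auto
    have "g \<otimes>\<^bsub>K\<^esub> u = (1, 0) \<otimes>\<^bsub>K\<^esub> (1 / T, 0)"
      unfolding u_def ff_shuffle(1) K_inv(2)[OF g(1)] ..
    then have "(1 / T, 0) \<in> P" using P.P_mult[OF gP uP] by simp
    then have "(T, 0) \<in> Units (K\<lparr>carrier := P\<rparr>)"
      unfolding Units_def using TP T_nonzero by simp (intro bexI[of _ "(1 / T, 0)"], simp_all)
    then show False using T by (simp add: local_max_ideal_def)
  qed
  ultimately show ?thesis by blast
qed

end


section \<open>Existence of the point over a ramified place\<close>

text \<open>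
  A chart ring \<open>A\<close> in which the place is finite. The family \<open>\<M>\<close> consists of valuations of \<open>\<complex>(x)\<close> for the
  points of the \<open>x\<close>-line below the chart: functions integral at all of them belong to \<open>A\<close>, and all
  functions of \<open>A\<close> satisfy the corresponding inequalities in \<open>K\<close>. The factor \<open>\<rho>\<close> must be such that \<open>\<rho> y\<close>,
  a uniformizer at the place, satisfies them too.
\<close>

locale place_in_chart = ramified_place \<nu> f \<rho> T for \<nu> f \<rho> T +
  fixes \<M> :: "(ratfun \<Rightarrow> int) set" and A :: "(ratfun \<times> ratfun) set"
  assumes \<M>_valuation: "\<mu> \<in> \<M> \<Longrightarrow> ratfun_valuation \<mu>"
    and \<nu>_in_\<M>: "\<nu> \<in> \<M>"
    and A_chart: "A \<in> chart_rings f"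
    and A_level: "\<mu> \<in> \<M> \<Longrightarrow> A \<subseteq> ratfun_valuation.level \<mu> f 0"
    and base_in_A: "(\<And>\<mu>. \<mu> \<in> \<M> \<Longrightarrow> z \<in> field_valuation.vball \<mu> 0) \<Longrightarrow> (z, 0) \<in> A"
    and T_integral: "\<mu> \<in> \<M> \<Longrightarrow> T \<in> field_valuation.vball \<mu> 0"
    and \<rho>_integral: "\<mu> \<in> \<M> \<Longrightarrow> \<rho> ^ 2 * to_fract f \<in> field_valuation.vball \<mu> 0"
begin

text \<open>
  The integral closure of \<open>A\<close> in valuation-theoretic form (\<open>integral_closure_A\<close>). Unlike for the integral
  closure, it is evident that this is a ring.
\<close>

definition S :: "(ratfun \<times> ratfun) set" where
  "S = {h. \<forall>\<mu> \<in> \<M>. h \<in> ratfun_valuation.level \<mu> f 0}"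

definition M :: "(ratfun \<times> ratfun) set" where
  "M = S \<inter> level f 1"

lemma S_add: "h \<in> S \<Longrightarrow> h' \<in> S \<Longrightarrow> h \<oplus>\<^bsub>K\<^esub> h' \<in> S"
  unfolding S_def using ratfun_valuation.level_add[OF \<M>_valuation] by blast

lemma S_mult: "h \<in> S \<Longrightarrow> h' \<in> S \<Longrightarrow> h \<otimes>\<^bsub>K\<^esub> h' \<in> S"
  unfolding S_def using ratfun_valuation.level_mult[OF \<M>_valuation, of _ _ f 0 _ 0] by simp

lemma S_minus: "h \<in> S \<Longrightarrow> \<ominus>\<^bsub>K\<^esub> h \<in> S"
  unfolding S_def using ratfun_valuation.level_minus[OF \<M>_valuation] by blast

lemma S_const: "const_fun c \<in> S"
  unfolding S_def using ratfun_valuation.level_const[OF \<M>_valuation] by blast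

lemma S_1: "(1, 0) \<in> S"
  unfolding S_def using ratfun_valuation.level_1[OF \<M>_valuation] by blast

lemma S_level: "h \<in> S \<Longrightarrow> h \<in> level f 0"
  unfolding S_def using \<nu>_in_\<M> by blast

lemma S_subring: "subring S K"
proof -
  interpret cring K by (rule ff_cring)
  show ?thesis
    by (rule subringI) (simp_all add: S_1 S_minus S_add S_mult)
qed

lemma S_ev: "(ev T p, 0) \<in> S"
  unfolding S_def
proof (clarify)
  fix \<mu> assume "\<mu> \<in> \<M>"
  then interpret \<mu>: ratfun_valuation \<mu> by (rule \<M>_valuation)
  have "ev T p \<in> \<mu>.vball 0"
    using \<mu>.ev_in_vball T_integral \<open>\<mu> \<in> \<M>\<close> by blast
  then show "(ev T p, 0) \<in> \<mu>.level f 0"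
    using \<mu>.vball_mult[of "ev T p" 0 "ev T p" 0] by (simp add: \<mu>.level_iff power2_eq_square)
qed

lemma S_\<rho>: "(0, \<rho>) \<in> S"
  unfolding S_def
proof (clarify)
  fix \<mu> assume "\<mu> \<in> \<M>"
  then interpret \<mu>: ratfun_valuation \<mu> by (rule \<M>_valuation)
  show "(0, \<rho>) \<in> \<mu>.level f 0"
    using \<rho>_integral[OF \<open>\<mu> \<in> \<M>\<close>] by (simp add: \<mu>.level_iff)
qed

lemma A_subring: "subring A K"
  using A_chart chart_ring_subring by (auto simp: chart_rings_def)

text \<open>
  Integral elements satisfy the inequalities by \<open>integral_closure_level\<close>. Conversely, for \<open>a + b y\<close> in \<open>S\<close>
  the coefficients \<open>- 2 a\<close> and \<open>a\<^sup>2 - b\<^sup>2 f\<close> of its characteristic polynomial are integral for all of \<open>\<M>\<close>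
  and so belong to \<open>A\<close>.
\<close>

lemma integral_closure_A: "integral_closure K A = S"
proof (intro equalityI subsetI)
  fix h assume h: "h \<in> integral_closure K A"
  show "h \<in> S"
    unfolding S_def
  proof (clarify)
    fix \<mu> assume \<mu>: "\<mu> \<in> \<M>"
    show "h \<in> ratfun_valuation.level \<mu> f 0"
      by (rule ratfun_valuation.integral_closure_level
        [OF \<M>_valuation[OF \<mu>] f_nonzero A_subring A_level[OF \<mu>] h])
  qed
next
  fix h assume "h \<in> S"
  obtain a b where ab: "h = (a, b)" by (cases h)
  have lev: "(a, b) \<in> ratfun_valuation.level \<mu> f 0" if "\<mu> \<in> \<M>" for \<mu>
    using \<open>h \<in> S\<close> that unfolding S_def ab by blast
  have "(- 2 * a, 0) \<in> A"
  proof (rule base_in_A)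
    fix \<mu> assume \<mu>: "\<mu> \<in> \<M>"
    then interpret \<mu>: ratfun_valuation \<mu> by (rule \<M>_valuation)
    have "a ^ 2 \<in> \<mu>.vball 0" using lev[OF \<mu>] unfolding \<mu>.level_iff by blast
    then have a: "a \<in> \<mu>.vball 0" unfolding \<mu>.vball_square by (auto simp: \<mu>.vball_def)
    have "- 2 * a = - (a + a)" by simp
    then show "- 2 * a \<in> \<mu>.vball 0"
      using \<mu>.vball_minus[OF \<mu>.vball_add[OF a a]] by metis
  qed
  moreover have "(ff_norm f (a, b), 0) \<in> A"
  proof (rule base_in_A)
    fix \<mu> assume \<mu>: "\<mu> \<in> \<M>"
    then interpret \<mu>: ratfun_valuation \<mu> by (rule \<M>_valuation)
    show "ff_norm f (a, b) \<in> \<mu>.vball 0"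
      by (rule \<mu>.level_norm[OF lev[OF \<mu>]])
  qed
  ultimately show "h \<in> integral_closure K A"
    unfolding ab by (rule integral_closure_quadratic[OF A_subring])
qed

text \<open>
  The residue field of \<open>V\<close> is \<open>\<complex>\<close>: the summand \<open>b y\<close> has odd value and vanishes as soon as it is integral,
  and \<open>a\<close> is constant modulo \<open>T\<close>.
\<close>

lemma kval_residue:
  assumes "h \<in> level f 0"
  shows "\<exists>c. h \<oplus>\<^bsub>K\<^esub> const_fun c \<in> level f 1"
proof -
  obtain a b where ab: "h = (a, b)" by (cases h)
  have h: "a ^ 2 \<in> vball 0" "b ^ 2 * to_fract f \<in> vball 0"
    using assms by (simp_all add: ab level_iff)
  have "a \<in> vball 0" using h(1) unfolding vball_square by (auto simp: vball_def)
  then obtain c where c: "a - to_fract [:c:] \<in> vball 1" using residue by blast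
  have "b ^ 2 * to_fract f \<in> vball 1"
  proof -
    have "2 * \<nu> b + \<nu> (to_fract f) \<noteq> 0" using odd_val_f by presburger
    then show ?thesis using h(2) unfolding vball_square_mult[OF to_fract_f_nonzero] by linarith
  qed
  moreover have "(a - to_fract [:c:]) ^ 2 \<in> vball 1"
    using c unfolding vball_square by (auto simp: vball_def)
  moreover have "to_fract [:- c:] = - to_fract [:c:]"
    by (simp only: to_fract_uminus[symmetric]) simp
  ultimately show ?thesis
    by (intro exI[of _ "- c"]) (simp add: ab const_fun_def level_iff)
qed

lemma ideal_M: "ideal M (K\<lparr>carrier := S\<rparr>)"
proof (rule idealI)
  interpret cring K by (rule ff_cring)
  show S: "ring (K\<lparr>carrier := S\<rparr>)" by (rule subring_is_ring[OF S_subring])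
  interpret S: ring "K\<lparr>carrier := S\<rparr>" by (rule S)
  have minus: "\<ominus>\<^bsub>K\<lparr>carrier := S\<rparr>\<^esub> h = \<ominus>\<^bsub>K\<^esub> h" if "h \<in> S" for h
    using S.minus_equality[of "\<ominus>\<^bsub>K\<^esub> h" h] that S_minus[OF that] l_neg[of h] by simp
  show "subgroup M (add_monoid (K\<lparr>carrier := S\<rparr>))"
  proof (rule S.add.subgroupI)
    show "M \<subseteq> carrier (K\<lparr>carrier := S\<rparr>)" by (auto simp: M_def)
    show "M \<noteq> {}"
      using S_const[of 0] level_0[of f 1] by (auto simp: M_def const_fun_def)
    show "\<ominus>\<^bsub>K\<lparr>carrier := S\<rparr>\<^esub> h \<in> M" if "h \<in> M" for h
      using that minus[of h] S_minus[of h] level_minus[of h f 1] by (simp add: M_def)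
    show "h \<oplus>\<^bsub>K\<lparr>carrier := S\<rparr>\<^esub> h' \<in> M" if "h \<in> M" "h' \<in> M" for h h'
      using that S_add[of h h'] level_add[of h f 1 h'] by (simp add: M_def)
  qed
  show "h' \<otimes>\<^bsub>K\<lparr>carrier := S\<rparr>\<^esub> h \<in> M" "h \<otimes>\<^bsub>K\<lparr>carrier := S\<rparr>\<^esub> h' \<in> M"
    if "h \<in> M" "h' \<in> carrier (K\<lparr>carrier := S\<rparr>)" for h h'
    using that S_mult[of h h'] S_mult[of h' h] level_mult[of h' f 0 h 1] level_mult[of h f 1 h' 0]
      S_level[of h'] by (simp_all add: M_def)
qed

lemma const_unit: "c \<noteq> 0 \<Longrightarrow> const_fun (1 / c) \<otimes>\<^bsub>K\<^esub> const_fun c = (1, 0)"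
proof -
  assume "c \<noteq> 0"
  then have "to_fract [:1 / c:] * to_fract [:c:] = 1"
    by (simp only: to_fract_mult[symmetric]) (simp add: pCons_one)
  then show ?thesis by (simp add: const_fun_def)
qed

text \<open>
  An ideal that contains \<open>M\<close> and some \<open>h\<close> outside of it contains the nonzero constant to which \<open>h\<close> is
  congruent.
\<close>

lemma maximalideal_M: "maximalideal M (K\<lparr>carrier := S\<rparr>)"
proof (rule maximalidealI[OF ideal_M])
  have "(1, 0) \<notin> level f 1" by (simp add: level_kval)
  then show "carrier (K\<lparr>carrier := S\<rparr>) \<noteq> M"
    using S_1 by (auto simp: M_def)
next
  fix J assume J: "ideal J (K\<lparr>carrier := S\<rparr>)" "M \<subseteq> J" "J \<subseteq> carrier (K\<lparr>carrier := S\<rparr>)"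
  interpret J: ideal J "K\<lparr>carrier := S\<rparr>" by (rule J)
  have Jadd: "x \<in> J \<Longrightarrow> y \<in> J \<Longrightarrow> x \<oplus>\<^bsub>K\<^esub> y \<in> J" for x y
    using additive_subgroup.a_closed[OF J.additive_subgroup_axioms, of x y] by simp
  have Jmult: "x \<in> J \<Longrightarrow> y \<in> S \<Longrightarrow> y \<otimes>\<^bsub>K\<^esub> x \<in> J" for x y
    using J.I_l_closed[of x y] by simp
  show "J = M \<or> J = carrier (K\<lparr>carrier := S\<rparr>)"
  proof (cases "J \<subseteq> M")
    case False
    then obtain h where h: "h \<in> J" "h \<notin> M" by blast
    have hS: "h \<in> S" using h J(3) by auto
    obtain c where c: "h \<oplus>\<^bsub>K\<^esub> const_fun c \<in> level f 1"
      using kval_residue[OF S_level[OF hS]] by blast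
    have "c \<noteq> 0"
    proof
      assume "c = 0"
      then have "h \<in> level f 1" using c by (cases h) (simp add: const_fun_def)
      then show False using h hS by (simp add: M_def)
    qed
    have "h \<oplus>\<^bsub>K\<^esub> const_fun c \<in> J"
      using c S_add[OF hS S_const] J(2) by (auto simp: M_def)
    moreover have "const_fun (- 1) \<otimes>\<^bsub>K\<^esub> h \<in> J" by (rule Jmult[OF h(1) S_const])
    ultimately have "(h \<oplus>\<^bsub>K\<^esub> const_fun c) \<oplus>\<^bsub>K\<^esub> (const_fun (- 1) \<otimes>\<^bsub>K\<^esub> h) \<in> J" by (rule Jadd)
    moreover have "(h \<oplus>\<^bsub>K\<^esub> const_fun c) \<oplus>\<^bsub>K\<^esub> (const_fun (- 1) \<otimes>\<^bsub>K\<^esub> h) = const_fun c"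
      by (cases h) (simp add: const_fun_def to_fract_const_minus_1)
    ultimately have "const_fun (1 / c) \<otimes>\<^bsub>K\<^esub> const_fun c \<in> J"
      using Jmult[OF _ S_const] by simp
    then have one: "(1, 0) \<in> J" using const_unit[OF \<open>c \<noteq> 0\<close>] by simp
    have "S \<subseteq> J"
    proof
      fix y assume "y \<in> S"
      then show "y \<in> J" using Jmult[OF one, of y] by (cases y) simp
    qed
    then show ?thesis using J(3) by auto
  qed (use J(2) in blast)
qed

text \<open>
  For \<open>a + b y\<close> in \<open>V\<close> both \<open>a\<close> and \<open>b / \<rho>\<close> are quotients of polynomials in \<open>T\<close> with denominators that do
  not vanish at \<open>T = 0\<close>: for \<open>b / \<rho>\<close> because \<open>2 \<nu>(b / \<rho>) \<ge> -1\<close> forces \<open>\<nu>(b / \<rho>) \<ge> 0\<close>. The product of the two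
  denominators clears both.
\<close>

lemma localization_S: "localization_at K S M = V"
proof (intro equalityI subsetI)
  fix h assume "h \<in> localization_at K S M"
  then obtain a s where as: "h = a \<otimes>\<^bsub>K\<^esub> inv\<^bsub>K\<^esub> s" "a \<in> S" "s \<in> S - M"
    by (auto simp: localization_at_def)
  then have s: "s \<noteq> (0, 0)" "kval s = 0"
    using S_level[of s] level_0[of f 1] by (auto simp: M_def level_kval)
  have "inv\<^bsub>K\<^esub> s \<in> level f 0" using K_inv[OF s(1)] s(2) by (simp add: level_kval)
  then show "h \<in> V"
    using level_mult[OF S_level[OF as(2)], of "inv\<^bsub>K\<^esub> s" 0] by (simp add: as(1) V_def)
next
  fix h assume h: "h \<in> V"
  obtain a b where ab: "h = (a, b)" by (cases h)
  have "a ^ 2 \<in> vball 0" "b ^ 2 * to_fract f \<in> vball 0"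
    using h by (simp_all add: V_def ab level_iff)
  then have "a \<in> vball 0" and b: "b = 0 \<or> 0 \<le> 2 * \<nu> b + \<nu> (to_fract f)"
    unfolding vball_square vball_square_mult[OF to_fract_f_nonzero] by (simp_all add: vball_def)
  then obtain p q where pq: "poly q 0 \<noteq> 0" "a = ev T p / ev T q" using vball_ev by blast
  have "b / \<rho> \<in> vball 0"
    using b val_\<rho> val_divide[OF _ \<rho>_nonzero, of b] by (auto simp: vball_def)
  then obtain r s where rs: "poly s 0 \<noteq> 0" "b / \<rho> = ev T r / ev T s" using vball_ev by blast
  define d where "d = (ev T q, 0) \<otimes>\<^bsub>K\<^esub> (ev T s, 0)"
  define n where "n = (ev T p, 0) \<otimes>\<^bsub>K\<^esub> (ev T s, 0) \<oplus>\<^bsub>K\<^esub> (ev T r, 0) \<otimes>\<^bsub>K\<^esub> (ev T q, 0) \<otimes>\<^bsub>K\<^esub> (0, \<rho>)"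
  have d: "d \<in> S" and n: "n \<in> S"
    unfolding d_def n_def by (intro S_add S_mult S_ev S_\<rho>)+
  note u = ev_unit[OF pq(1)] ev_unit[OF rs(1)]
  have kd: "d \<noteq> (0, 0)" "kval d = 0"
    using u kval_formula[of "ev T q * ev T s" 0] by (simp_all add: d_def val_mult)
  then have "d \<notin> M" by (simp add: M_def level_kval)
  have b': "b = \<rho> * (ev T r / ev T s)" using rs(2) \<rho>_nonzero by (simp add: field_simps)
  have "h \<otimes>\<^bsub>K\<^esub> d = n"
    using u by (simp add: ab d_def n_def pq(2) b' field_simps)
  then have "n \<otimes>\<^bsub>K\<^esub> inv\<^bsub>K\<^esub> d = h \<otimes>\<^bsub>K\<^esub> (d \<otimes>\<^bsub>K\<^esub> inv\<^bsub>K\<^esub> d)"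
    by (simp only: ff_shuffle(1))
  also have "\<dots> = h" unfolding K_inv(2)[OF kd(1)] by (simp add: ab)
  finally have "h = n \<otimes>\<^bsub>K\<^esub> inv\<^bsub>K\<^esub> d" ..
  then show "h \<in> localization_at K S M"
    unfolding localization_at_def using d n \<open>d \<notin> M\<close> by blast
qed

lemma V_point: "V \<in> normalization_points f"
  unfolding normalization_points_def
  using A_chart integral_closure_A maximalideal_M localization_S by blast

lemma the_point: "(THE P. P \<in> normalization_points f \<and> (T, 0) \<in> local_max_ideal f P) = V"
proof (rule the_equality)
  have "kval (T, 0) = 2" using kval_formula[of T 0] T_nonzero val_T by simp
  then show "V \<in> normalization_points f \<and> (T, 0) \<in> local_max_ideal f V"
    by (simp add: V_point local_max_ideal_V level_kval)
qed (use point_unique in blast)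

end


section \<open>The points of \<open>C\<^sub>j\<close> over \<open>0\<close> and \<open>\<infinity>\<close>\<close>

abbreviation xr :: ratfun where
  "xr \<equiv> to_fract [:0, 1:]"

lemma ev_xr: "ev xr p = to_fract p"
proof (induction p)
  case (pCons c p)
  have "pCons c p = [:c:] + [:0, 1:] * p" by simp
  then show ?case
    unfolding ev_pCons pCons.IH by (metis to_fract_add to_fract_mult)
qed simp

lemma xr_power: "xr ^ n = to_fract (Polynomial.monom 1 n)"
  by (induction n) (simp_all add: monom_Suc monom_0 pCons_one flip: to_fract_mult)

lemma ev_in_subring:
  assumes "subring A (function_field f)" "\<And>c. const_fun c \<in> A" "(T, 0) \<in> A"
  shows "(ev T p, 0) \<in> A"
  by (rule ev_closed[OF subringE(7)[OF assms(1)] subringE(6)[OF assms(1)] assms(2,3)])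

lemma (in ratfun_valuation) generate_ring_level:
  assumes "G \<subseteq> level f 0"
  shows "generate_ring (function_field f) G \<subseteq> level f 0"
proof
  fix h assume "h \<in> generate_ring (function_field f) G"
  then show "h \<in> level f 0"
  proof (induction rule: generate_ring.induct)
    case one
    show ?case using level_1 by simp
  next
    case (eng_mult h1 h2)
    then show ?case using level_mult[of h1 f 0 h2 0] by simp
  qed (use assms in \<open>auto intro: level_minus level_add\<close>)
qed

lemma poly_in_vball_pt: "to_fract p \<in> ord_pt.vball c 0"
  by (cases "p = 0") (simp_all add: ord_pt.vball_def ord_pt_poly)

text \<open>Writing \<open>p / x\<^sup>n\<close> as a polynomial in \<open>1 / x\<close> reverses the coefficients of \<open>p\<close>.\<close>

lemma ev_reverse:
  assumes "Polynomial.degree p \<le> n"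
  shows "\<exists>r. ev (1 / xr) r = to_fract p / xr ^ n \<and> poly r 0 = Polynomial.coeff p n"
  using assms
proof (induction n arbitrary: p)
  case 0
  then obtain c where "p = [:c:]" by (metis degree_eq_zeroE le_zero_eq)
  then show ?case by (intro exI[of _ "[:c:]"]) simp
next
  case (Suc n)
  obtain c q where p: "p = pCons c q" by (cases p)
  have "Polynomial.degree q \<le> n"
    using Suc.prems p by (cases "q = 0") auto
  then obtain r where r: "ev (1 / xr) r = to_fract q / xr ^ n" "poly r 0 = Polynomial.coeff q n"
    using Suc.IH by blast
  have evm: "ev (1 / xr) (Polynomial.monom c m) = to_fract [:c:] / xr ^ m" for m
    by (induction m) (simp_all add: monom_0 monom_Suc)
  have ev_add: "ev T (u + v) = ev T u + ev T v" for T u v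
  proof (induction u arbitrary: v)
    case (pCons a u)
    obtain b w where v: "v = pCons b w" by (cases v)
    have "to_fract [:a + b:] = to_fract [:a:] + to_fract [:b:]"
      by (simp flip: to_fract_add)
    then show ?case by (simp add: v pCons.IH algebra_simps)
  qed simp
  have "to_fract p = to_fract [:c:] + xr * to_fract q"
    unfolding p to_fract_mult[symmetric] to_fract_add[symmetric] by simp
  then have "ev (1 / xr) (Polynomial.monom c (Suc n) + r) = to_fract p / xr ^ Suc n"
    unfolding ev_add evm r(1) by (simp add: field_simps)
  moreover have "poly (Polynomial.monom c (Suc n) + r) 0 = Polynomial.coeff p (Suc n)"
    by (simp add: poly_monom r(2) p)
  ultimately show ?case by blast
qed

locale curve =
  fixes j :: nat and b a1 a2 :: complex and f :: "complex poly"
  assumes j: "1 \<le> j" and b: "b \<noteq> 0" and a1: "a1 \<noteq> 0" and a2: "a2 \<noteq> 0"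
    and f: "f = curve_poly j b a1 a2"
begin

abbreviation g :: "complex poly" where
  "g \<equiv> [:- a1, 1:] * [:- a2, 1:]"

lemma f_eq: "f = Polynomial.smult b (Polynomial.monom 1 (2 * j - 1) * g)"
  unfolding f curve_poly_def by (simp only: mult.assoc)

lemma g_nz: "g \<noteq> 0" and degree_g: "Polynomial.degree g = 2" and order_g: "Polynomial.order 0 g = 0"
proof -
  show "g \<noteq> 0" by (simp del: mult_pCons_left mult_pCons_right)
  show "Polynomial.degree g = 2"
    by (simp add: degree_mult_eq del: mult_pCons_left mult_pCons_right)
  show "Polynomial.order 0 g = 0"
    using a1 a2 by (intro order_0I) simp
qed

lemma f_nz: "f \<noteq> 0"
  unfolding f_eq using b g_nz by (simp del: mult_pCons_left mult_pCons_right)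

lemma degree_f: "Polynomial.degree f = 2 * j + 1"
  unfolding f_eq using b j g_nz degree_g
  by (simp add: degree_mult_eq degree_monom_eq del: mult_pCons_left mult_pCons_right)

lemma order_f: "Polynomial.order 0 f = 2 * j - 1"
proof -
  have "Polynomial.monom 1 (2 * j - 1) * g \<noteq> 0"
    using g_nz by (simp del: mult_pCons_left mult_pCons_right)
  then show ?thesis
    unfolding f_eq order_smult[OF b]
    by (simp add: order_mult order_g del: mult_pCons_left mult_pCons_right)
qed

lemma f_root: "poly f c = 0 \<Longrightarrow> c \<in> {0, a1, a2}"
  using b by (auto simp: f curve_poly_def poly_monom)

sublocale zero: ramified_place "ord_pt 0" f "1 / xr ^ (j - 1)" xr
proof
  show "f \<noteq> 0" by (rule f_nz)
  show "1 / xr ^ (j - 1) \<noteq> 0" "xr \<noteq> 0" by simp_all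
  have ox: "ord_pt 0 xr = 1"
    using ord_pt_poly[of "[:0, 1:]" 0] order_power_n_n[of "0 :: complex" 1] by simp
  then show "ord_pt 0 xr = 1" .
  show "2 * ord_pt 0 (1 / xr ^ (j - 1)) + ord_pt 0 (to_fract f) = 1"
    using j f_nz ox
    by (simp add: ord_pt.val_divide ord_pt.val_power ord_pt_poly order_f)
  fix z assume z: "z \<in> ord_pt.vball 0 0"
  show "\<exists>p q. poly q 0 \<noteq> 0 \<and> z = ev xr p / ev xr q"
  proof (cases "z = 0")
    case True
    then show ?thesis by (intro exI[of _ 0] exI[of _ 1]) simp
  next
    case False
    obtain p q where pq: "z = to_fract p / to_fract q" "q \<noteq> 0" "coprime p q"
      by (rule ratfun_cases)
    have p: "p \<noteq> 0" using False pq by auto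
    have "poly q 0 \<noteq> 0"
    proof
      assume q0: "poly q 0 = 0"
      then have "Polynomial.order 0 q > 0" using pq by (simp add: order_gt_0_iff)
      then have "Polynomial.order 0 p > 0"
        using z False ord_pt_quot[OF p pq(2), of 0] by (simp add: ord_pt.vball_def pq(1))
      then have "poly p 0 = 0" using p by (simp add: order_gt_0_iff)
      then show False using q0 coprime_poly_0[OF pq(3)] by blast
    qed
    then show ?thesis using pq(1) ev_xr by metis
  qed
qed

sublocale infty: ramified_place ord_infty f "1 / xr ^ (j + 1)" "1 / xr"
proof
  show "f \<noteq> 0" by (rule f_nz)
  show "1 / xr ^ (j + 1) \<noteq> 0" "1 / xr \<noteq> 0" by simp_all
  have ox: "ord_infty xr = - 1"
    using ord_infty_poly[of "[:0, 1:]"] by simp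
  then show "ord_infty (1 / xr) = 1" by (simp add: ord_infty.val_divide)
  show "2 * ord_infty (1 / xr ^ (j + 1)) + ord_infty (to_fract f) = 1"
    using f_nz ox
    by (simp add: ord_infty.val_divide ord_infty.val_power ord_infty_poly degree_f del: power_Suc)
  fix z assume z: "z \<in> ord_infty.vball 0"
  show "\<exists>p q. poly q 0 \<noteq> 0 \<and> z = ev (1 / xr) p / ev (1 / xr) q"
  proof (cases "z = 0")
    case True
    then show ?thesis by (intro exI[of _ 0] exI[of _ 1]) simp
  next
    case False
    obtain p q where pq: "z = to_fract p / to_fract q" "q \<noteq> 0" "coprime p q"
      by (rule ratfun_cases)
    have p: "p \<noteq> 0" using False pq by auto
    have "Polynomial.degree p \<le> Polynomial.degree q"
      using z False ord_infty_quot[OF p pq(2)] by (simp add: ord_infty.vball_def pq(1))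
    then obtain r where r: "ev (1 / xr) r = to_fract p / xr ^ Polynomial.degree q"
      using ev_reverse by blast
    obtain s where s: "ev (1 / xr) s = to_fract q / xr ^ Polynomial.degree q"
      "poly s 0 = Polynomial.coeff q (Polynomial.degree q)"
      using ev_reverse[of q "Polynomial.degree q"] by blast
    have "poly s 0 \<noteq> 0" using s(2) pq(2) by simp
    moreover have "z = ev (1 / xr) r / ev (1 / xr) s" by (simp add: r s(1) pq(1))
    ultimately show ?thesis by blast
  qed
qed

abbreviation K :: "(ratfun \<times> ratfun) ring" where
  "K \<equiv> function_field f"

lemma inv_eqI: "h \<otimes>\<^bsub>K\<^esub> h' = (1, 0) \<Longrightarrow> inv\<^bsub>K\<^esub> h = h'"
proof -
  interpret cring K by (rule ff_cring)
  assume "h \<otimes>\<^bsub>K\<^esub> h' = (1, 0)"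
  then have "h \<otimes>\<^bsub>K\<^esub> h' = \<one>\<^bsub>K\<^esub>" "h' \<otimes>\<^bsub>K\<^esub> h = \<one>\<^bsub>K\<^esub>" using m_comm[of h h'] by simp_all
  then show ?thesis using inv_unique'[of h h'] by simp
qed

lemma inv_x: "inv\<^bsub>K\<^esub> x_fun = (1 / xr, 0)"
  by (rule inv_eqI) (simp add: x_fun_def)

lemma inv_y: "inv\<^bsub>K\<^esub> y_fun = (0, 1 / to_fract f)"
  by (rule inv_eqI) (simp add: y_fun_def f_nz)

sublocale zero_chart: place_in_chart "ord_pt 0" f "1 / xr ^ (j - 1)" xr "range ord_pt"
  "generate_ring K (range const_fun \<union> {x_fun, y_fun})"
proof (intro place_in_chart.intro place_in_chart_axioms.intro zero.ramified_place_axioms)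
  let ?A = "generate_ring K (range const_fun \<union> {x_fun, y_fun})"
  show "\<mu> \<in> range ord_pt \<Longrightarrow> ratfun_valuation \<mu>" for \<mu>
    using ord_pt.ratfun_valuation_axioms by auto
  show "ord_pt 0 \<in> range ord_pt" by simp
  show "?A \<in> chart_rings f" unfolding chart_rings_def by blast
  show "?A \<subseteq> ratfun_valuation.level \<mu> f 0" if \<mu>: "\<mu> \<in> range ord_pt" for \<mu>
  proof -
    obtain c where c: "\<mu> = ord_pt c" using \<mu> by blast
    have "x_fun \<in> ord_pt.level c f 0" "y_fun \<in> ord_pt.level c f 0"
      using poly_in_vball_pt[of "[:0, 1:] ^ 2" c] poly_in_vball_pt[of f c]
      by (simp_all add: x_fun_def y_fun_def ord_pt.level_iff power2_eq_square flip: to_fract_mult)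
    then show ?thesis
      unfolding c by (intro ord_pt.generate_ring_level) (auto intro: ord_pt.level_const)
  qed
  show "\<mu> \<in> range ord_pt \<Longrightarrow> xr \<in> field_valuation.vball \<mu> 0" for \<mu>
    using poly_in_vball_pt by auto
  have "(1 / xr ^ (j - 1)) ^ 2 * to_fract f = to_fract (Polynomial.smult b ([:0, 1:] * [:- a1, 1:] * [:- a2, 1:]))"
  proof -
    have e: "2 * j - 1 = (j - 1) + (j - 1) + 1" using j by simp
    have m: "Polynomial.monom 1 (2 * j - 1) =
        Polynomial.monom 1 (j - 1) * (Polynomial.monom 1 (j - 1) * [:0, 1 :: complex:])"
      unfolding e by (simp add: mult_monom monom_Suc)
    have "f = Polynomial.monom 1 (j - 1) * (Polynomial.monom 1 (j - 1) *
        Polynomial.smult b ([:0, 1:] * [:- a1, 1:] * [:- a2, 1:]))"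
      unfolding f curve_poly_def m by (simp only: mult_smult_right mult.assoc)
    then have "to_fract f = xr ^ (j - 1) * (xr ^ (j - 1) *
        to_fract (Polynomial.smult b ([:0, 1:] * [:- a1, 1:] * [:- a2, 1:])))"
      unfolding xr_power by (metis to_fract_mult)
    then show ?thesis by (simp add: power2_eq_square)
  qed
  then show "\<mu> \<in> range ord_pt \<Longrightarrow> (1 / xr ^ (j - 1)) ^ 2 * to_fract f \<in> field_valuation.vball \<mu> 0" for \<mu>
    using poly_in_vball_pt by auto
  fix z assume z: "\<And>\<mu>. \<mu> \<in> range ord_pt \<Longrightarrow> z \<in> field_valuation.vball \<mu> 0"
  obtain p q where pq: "z = to_fract p / to_fract q" "q \<noteq> 0" "coprime p q"
    by (rule ratfun_cases)
  have no_root: "poly q c \<noteq> 0" for c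
  proof
    assume q: "poly q c = 0"
    then have p: "poly p c \<noteq> 0" using coprime_poly_0[OF pq(3)] by blast
    then have "p \<noteq> 0" "Polynomial.order c p = 0" by (auto simp: order_0I)
    moreover have "Polynomial.order c q > 0" using q pq(2) by (simp add: order_gt_0_iff)
    ultimately show False
      using z[of "ord_pt c"] ord_pt_quot[of p q c] pq(2) by (auto simp: ord_pt.vball_def pq(1))
  qed
  then have "constant (poly q)" using fundamental_theorem_of_algebra by blast
  then obtain c where c: "q = [:c:]" by (metis constant_degree degree_eq_zeroE)
  have "c \<noteq> 0" using pq(2) c by simp
  then have "p = [:c:] * Polynomial.smult (1 / c) p" by simp
  then have "to_fract p = to_fract q * to_fract (Polynomial.smult (1 / c) p)"
    unfolding c by (metis to_fract_mult)
  then have "z = ev xr (Polynomial.smult (1 / c) p)"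
    using pq(2) by (simp add: pq(1) ev_xr)
  moreover have "(ev xr (Polynomial.smult (1 / c) p), 0) \<in> ?A"
    by (rule ev_in_subring[OF chart_ring_subring]) (auto intro: generate_ring.incl simp: x_fun_def)
  ultimately show "(z, 0) \<in> ?A" by simp
qed

lemma point_zero_V: "point_zero f = zero.V"
  using zero_chart.the_point by (simp add: point_zero_def x_fun_def)

text \<open>
  The valuations for the chart with coordinates \<open>1 / x\<close> and \<open>1 / y\<close>. The points over \<open>0\<close>, \<open>\<alpha>\<^sub>1\<close> and \<open>\<alpha>\<^sub>2\<close> lie
  outside of it, as \<open>1 / x\<close> or \<open>1 / y\<close> has a pole there.
\<close>

definition infty_valuations :: "(ratfun \<Rightarrow> int) set" where
  "infty_valuations = insert ord_infty (ord_pt ` (- {0, a1, a2}))"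

definition infty_chart_ring :: "(ratfun \<times> ratfun) set" where
  "infty_chart_ring = generate_ring K (range const_fun \<union> {inv\<^bsub>K\<^esub> x_fun, inv\<^bsub>K\<^esub> y_fun})"

lemma infty_chart_ring_subring: "subring infty_chart_ring K"
  unfolding infty_chart_ring_def by (rule chart_ring_subring)

lemma infty_chart_ring_closed:
  "h \<in> infty_chart_ring \<Longrightarrow> h' \<in> infty_chart_ring \<Longrightarrow> h \<otimes>\<^bsub>K\<^esub> h' \<in> infty_chart_ring"
  "h \<in> infty_chart_ring \<Longrightarrow> h' \<in> infty_chart_ring \<Longrightarrow> h \<oplus>\<^bsub>K\<^esub> h' \<in> infty_chart_ring"
  using subringE(6,7)[OF infty_chart_ring_subring] by blast+

lemma ev_in_infty_chart_ring: "(ev (1 / xr) p, 0) \<in> infty_chart_ring"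
  by (rule ev_in_subring[OF infty_chart_ring_subring])
    (auto intro: generate_ring.incl simp: infty_chart_ring_def inv_x)

lemma ev_linear: "ev T [:1, - r:] = 1 - to_fract [:r:] * T"
proof -
  have "to_fract [:- r:] = - to_fract [:r:]"
    unfolding to_fract_uminus[symmetric] by simp
  moreover have "to_fract [:1 :: complex:] = 1" by (simp add: pCons_one)
  ultimately show ?thesis by (simp add: mult.commute)
qed

lemma linear_nonzero: "xr - to_fract [:r:] \<noteq> 0"
proof -
  have "xr - to_fract [:r:] = to_fract [:- r, 1:]"
    unfolding to_fract_diff[symmetric] by simp
  then show ?thesis by simp
qed

text \<open>
  Put \<open>u = r / x\<close>, so that \<open>x / (x - r) = 1 / (1 - u)\<close>. The geometric series reduces this to
  \<open>u\<^bsup>N\<^esup> / (1 - u)\<close>, and for \<open>N = 2j + 1\<close> that is a polynomial in \<open>1 / x\<close> times \<open>1 / f = (1 / y)\<^sup>2\<close>.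
\<close>

lemma inverse_linear_in_chart:
  assumes r: "r = a1 \<or> r = a2"
  shows "(xr / (xr - to_fract [:r:]), 0) \<in> infty_chart_ring"
proof -
  define T where "T = 1 / xr"
  define u where "u = to_fract [:r:] * T"
  define N where "N = 2 * j + 1"
  obtain r' where r': "g = [:- r, 1:] * [:- r', 1:]"
    using r by (metis mult.commute)
  have lin: "to_fract [:- s, 1:] = xr - to_fract [:s:]" for s
    unfolding to_fract_diff[symmetric] by simp
  have f': "to_fract f = to_fract [:b:] * xr ^ (2 * j - 1) * (xr - to_fract [:r:]) * (xr - to_fract [:r':])"
  proof -
    have "f = [:b:] * Polynomial.monom 1 (2 * j - 1) * [:- r, 1:] * [:- r', 1:]"
      unfolding f_eq r' by (simp add: mult.assoc del: mult_pCons_right)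
    then show ?thesis unfolding xr_power lin[symmetric] by (metis to_fract_mult)
  qed
  have u1: "1 - u \<noteq> 0"
    using linear_nonzero[of r] by (simp add: u_def T_def field_simps)
  have w: "xr / (xr - to_fract [:r:]) = 1 / (1 - u)"
    using linear_nonzero[of r] u1 by (simp add: u_def T_def field_simps)
  have geom: "1 / (1 - u) = (\<Sum>i<N. u ^ i) + u ^ N * (1 / (1 - u))"
  proof -
    have "(1 - u) * (\<Sum>i<N. u ^ i) = 1 - u ^ N" by (simp add: one_diff_power_eq)
    then show ?thesis using u1 by (simp add: field_simps)
  qed
  have uA: "(u, 0) \<in> infty_chart_ring"
    using ev_in_infty_chart_ring[of "[:0, r:]"] by (simp add: u_def T_def mult.commute)
  have u_pow: "(u ^ i, 0) \<in> infty_chart_ring" for i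
  proof (induction i)
    case 0
    show ?case using subringE(3)[OF infty_chart_ring_subring] by simp
  next
    case (Suc i)
    then show ?case using infty_chart_ring_closed(1)[OF uA Suc] by simp
  qed
  have sum: "(\<Sum>i<n. u ^ i, 0) \<in> infty_chart_ring" for n :: nat
  proof (induction n)
    case 0
    show ?case using subringE(2)[OF infty_chart_ring_subring] by simp
  next
    case (Suc n)
    then show ?case using infty_chart_ring_closed(2)[OF Suc u_pow[of n]] by simp
  qed
  have "(0, 1 / to_fract f) \<in> infty_chart_ring"
    unfolding infty_chart_ring_def inv_y[symmetric] by (rule generate_ring.incl) simp
  then have inv_f: "(1 / to_fract f, 0) \<in> infty_chart_ring"
    using infty_chart_ring_closed(1)[of "(0, 1 / to_fract f)" "(0, 1 / to_fract f)"] f_nz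
    by (simp add: field_simps)
  have "T ^ N * (1 / (1 - u)) = to_fract [:b:] * ((1 - to_fract [:r':] * T) * (1 / to_fract f))"
  proof -
    have N: "xr ^ N = xr ^ (2 * j - 1) * xr * xr"
    proof -
      have "N = (2 * j - 1) + 2" using j by (simp add: N_def)
      then show ?thesis by (simp add: power_add power2_eq_square mult.assoc)
    qed
    have b': "to_fract [:b:] \<noteq> 0" using b by simp
    have "1 / (1 - u) = xr / (xr - to_fract [:r:])" using w by simp
    moreover have "T ^ N = 1 / (xr ^ (2 * j - 1) * xr * xr)"
      using N by (simp add: T_def power_divide)
    moreover have "1 - to_fract [:r':] * T = (xr - to_fract [:r':]) / xr"
      by (simp add: T_def field_simps)
    ultimately show ?thesis
      using b' linear_nonzero[of r] linear_nonzero[of r'] by (simp add: f')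
  qed
  moreover have "(to_fract [:b:] * ((1 - to_fract [:r':] * T) * (1 / to_fract f)), 0) \<in> infty_chart_ring"
  proof -
    have "(1 - to_fract [:r':] * T, 0) \<in> infty_chart_ring"
      using ev_in_infty_chart_ring[of "[:1, - r':]"] unfolding ev_linear T_def .
    from infty_chart_ring_closed(1)[OF ev_in_infty_chart_ring[of "[:b:]"] infty_chart_ring_closed(1)[OF this inv_f]]
    show ?thesis by simp
  qed
  ultimately have tail: "(T ^ N * (1 / (1 - u)), 0) \<in> infty_chart_ring" by simp
  have power_u: "u ^ N * (1 / (1 - u)) = ev (1 / xr) [:r ^ N:] * (T ^ N * (1 / (1 - u)))"
  proof -
    have "to_fract [:r ^ N:] = to_fract [:r:] ^ N"
    proof (induction N)
      case (Suc N)
      have "[:r ^ Suc N:] = [:r:] * [:r ^ N:]" by simp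
      then show ?case unfolding power_Suc Suc[symmetric] by (metis to_fract_mult)
    qed (simp add: pCons_one)
    then show ?thesis by (simp add: u_def power_mult_distrib)
  qed
  have "(u ^ N * (1 / (1 - u)), 0) \<in> infty_chart_ring"
    unfolding power_u using infty_chart_ring_closed(1)[OF ev_in_infty_chart_ring[of "[:r ^ N:]"] tail] by simp
  from infty_chart_ring_closed(2)[OF sum[of N] this]
  have "((\<Sum>i<N. u ^ i) + u ^ N * (1 / (1 - u)), 0) \<in> infty_chart_ring" by simp
  then show ?thesis unfolding w geom[symmetric] .
qed

text \<open>
  Up to a constant the left-hand side is the product of the factors \<open>x / (x - r)\<close> over the roots \<open>r\<close> of \<open>q\<close>.
\<close>

lemma inverse_poly_in_chart:
  assumes "q \<noteq> 0" "\<And>c. poly q c = 0 \<Longrightarrow> c \<in> {0, a1, a2}"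
  shows "(xr ^ Polynomial.degree q / to_fract q, 0) \<in> infty_chart_ring"
  using assms
proof (induction "Polynomial.degree q" arbitrary: q)
  case 0
  then obtain c where c: "q = [:c:]" by (metis degree_eq_zeroE)
  then have "c \<noteq> 0" using 0 by simp
  then have "to_fract [:1 / c:] * to_fract q = 1"
    unfolding c to_fract_mult[symmetric] by (simp add: pCons_one)
  then have "1 / to_fract q = to_fract [:1 / c:]"
    using 0 by (simp add: field_simps)
  then show ?case using ev_in_infty_chart_ring[of "[:1 / c:]"] 0 by (simp add: c)
next
  case (Suc n)
  have "\<not> constant (poly q)" using Suc.hyps(2) by (simp add: constant_degree)
  then obtain c where c: "poly q c = 0" using fundamental_theorem_of_algebra by blast
  then obtain r where r: "q = [:- c, 1:] * r" unfolding poly_eq_0_iff_dvd by (elim dvdE)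
  have r0: "r \<noteq> 0" using r Suc.prems by auto
  have deg: "Polynomial.degree q = Suc (Polynomial.degree r)"
    unfolding r using r0 by (subst degree_mult_eq) simp_all
  have IH: "(xr ^ Polynomial.degree r / to_fract r, 0) \<in> infty_chart_ring"
  proof (rule Suc.hyps(1))
    show "n = Polynomial.degree r" using deg Suc.hyps(2) by simp
    show "r \<noteq> 0" by (rule r0)
    show "poly r d = 0 \<Longrightarrow> d \<in> {0, a1, a2}" for d
      using Suc.prems(2)[of d] by (simp add: r)
  qed
  have lin: "to_fract [:- c, 1:] = xr - to_fract [:c:]"
    unfolding to_fract_diff[symmetric] by simp
  have "(xr / (xr - to_fract [:c:]), 0) \<in> infty_chart_ring"
  proof (cases "c = 0")
    case True
    then show ?thesis using subringE(3)[OF infty_chart_ring_subring] by simp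
  next
    case False
    then show ?thesis using Suc.prems(2)[OF c] by (intro inverse_linear_in_chart) simp
  qed
  from infty_chart_ring_closed(1)[OF this IH] show ?case
    unfolding deg using r lin by (simp del: mult_pCons_left)
qed

lemma ord_pt_xr: "c \<noteq> 0 \<Longrightarrow> ord_pt c xr = 0"
  using ord_pt_poly[of "[:0, 1:]" c] order_0I[of "[:0, 1:]" c] by simp

lemma ord_pt_f: "c \<notin> {0, a1, a2} \<Longrightarrow> ord_pt c (to_fract f) = 0"
  using ord_pt_poly[of f c] order_0I[of f c] f_nz f_root[of c] by auto

lemma ord_infty_xr: "ord_infty xr = - 1"
  using ord_infty_poly[of "[:0, 1:]"] by simp

lemma ord_infty_f: "ord_infty (to_fract f) = - (2 * int j + 1)"
  using ord_infty_poly[of f] f_nz degree_f by simp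

sublocale infty_chart: place_in_chart ord_infty f "1 / xr ^ (j + 1)" "1 / xr" infty_valuations
  infty_chart_ring
proof (intro place_in_chart.intro place_in_chart_axioms.intro infty.ramified_place_axioms)
  have valuation: "ratfun_valuation \<mu>" if "\<mu> \<in> infty_valuations" for \<mu>
    using that ord_pt.ratfun_valuation_axioms ord_infty.ratfun_valuation_axioms
    by (auto simp: infty_valuations_def)
  then show "\<mu> \<in> infty_valuations \<Longrightarrow> ratfun_valuation \<mu>" for \<mu> .
  show "ord_infty \<in> infty_valuations" by (simp add: infty_valuations_def)
  show "infty_chart_ring \<in> chart_rings f"
    unfolding chart_rings_def infty_chart_ring_def by blast
  have vals: "\<mu> xr \<le> 0 \<and> \<mu> (to_fract f) \<le> 0 \<and> 0 \<le> \<mu> (to_fract f) - (2 * int j + 2) * \<mu> xr"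
    if \<mu>: "\<mu> \<in> infty_valuations" for \<mu>
    using \<mu> ord_pt_xr ord_pt_f ord_infty_xr ord_infty_f by (auto simp: infty_valuations_def)
  show "1 / xr \<in> field_valuation.vball \<mu> 0" if \<mu>: "\<mu> \<in> infty_valuations" for \<mu>
  proof -
    interpret \<mu>: ratfun_valuation \<mu> by (rule valuation[OF \<mu>])
    show ?thesis using vals[OF \<mu>] by (simp add: \<mu>.vball_def \<mu>.val_divide)
  qed
  show "(1 / xr ^ (j + 1)) ^ 2 * to_fract f \<in> field_valuation.vball \<mu> 0"
    if \<mu>: "\<mu> \<in> infty_valuations" for \<mu>
  proof -
    interpret \<mu>: ratfun_valuation \<mu> by (rule valuation[OF \<mu>])
    have "\<mu> (1 / xr ^ (j + 1)) = - (int j + 1) * \<mu> xr"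
      by (simp add: \<mu>.val_divide \<mu>.val_power algebra_simps del: power_Suc)
    moreover have "to_fract f \<noteq> 0" "1 / xr ^ (j + 1) \<noteq> 0" using f_nz by simp_all
    ultimately show ?thesis
      using vals[OF \<mu>] unfolding \<mu>.vball_square_mult[OF \<open>to_fract f \<noteq> 0\<close>]
      by (simp add: algebra_simps)
  qed
  show "infty_chart_ring \<subseteq> ratfun_valuation.level \<mu> f 0" if \<mu>: "\<mu> \<in> infty_valuations" for \<mu>
  proof -
    interpret \<mu>: ratfun_valuation \<mu> by (rule valuation[OF \<mu>])
    have "(1 / xr, 0) \<in> \<mu>.level f 0"
      using vals[OF \<mu>] by (simp add: \<mu>.level_iff \<mu>.vball_square \<mu>.val_divide del: power_divide)
    moreover have "to_fract f \<noteq> 0" using f_nz by simp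
    then have "(0, 1 / to_fract f) \<in> \<mu>.level f 0"
      using vals[OF \<mu>] unfolding \<mu>.level_iff \<mu>.vball_square_mult[OF \<open>to_fract f \<noteq> 0\<close>]
      by (simp add: \<mu>.val_divide)
    ultimately show ?thesis
      unfolding infty_chart_ring_def inv_x inv_y
      by (intro \<mu>.generate_ring_level) (auto intro: \<mu>.level_const)
  qed
  fix z assume z: "\<And>\<mu>. \<mu> \<in> infty_valuations \<Longrightarrow> z \<in> field_valuation.vball \<mu> 0"
  show "(z, 0) \<in> infty_chart_ring"
  proof (cases "z = 0")
    case True
    then show ?thesis using ev_in_infty_chart_ring[of 0] by simp
  next
    case False
    obtain p q where pq: "z = to_fract p / to_fract q" "q \<noteq> 0" "coprime p q"
      by (rule ratfun_cases)
    have p0: "p \<noteq> 0" using False pq by auto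
    have roots: "c \<in> {0, a1, a2}" if c: "poly q c = 0" for c
    proof (rule ccontr)
      assume n: "c \<notin> {0, a1, a2}"
      have "poly p c \<noteq> 0" using c coprime_poly_0[OF pq(3)] by blast
      then have "Polynomial.order c p = 0" by (rule order_0I)
      moreover have "Polynomial.order c q > 0" using c pq(2) by (simp add: order_gt_0_iff)
      moreover have "z \<in> ord_pt.vball c 0" using z n by (simp add: infty_valuations_def)
      ultimately show False
        using False ord_pt_quot[OF p0 pq(2), of c] by (simp add: ord_pt.vball_def pq(1))
    qed
    have "z \<in> ord_infty.vball 0" using z by (simp add: infty_valuations_def)
    then have "Polynomial.degree p \<le> Polynomial.degree q"
      using False ord_infty_quot[OF p0 pq(2)] by (simp add: ord_infty.vball_def pq(1))
    then obtain r where r: "ev (1 / xr) r = to_fract p / xr ^ Polynomial.degree q"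
      using ev_reverse by blast
    have "z = ev (1 / xr) r * (xr ^ Polynomial.degree q / to_fract q)"
      by (simp add: r pq(1))
    then show ?thesis
      using infty_chart_ring_closed(1)[OF ev_in_infty_chart_ring[of r] inverse_poly_in_chart[OF pq(2) roots]]
      by simp
  qed
qed

lemma point_infinity_V: "point_infinity f = infty.V"
  using infty_chart.the_point by (simp add: point_infinity_def inv_x)

text \<open>
  Every chart contains \<open>x\<close> or \<open>1 / x\<close>. If \<open>x\<close> were not regular at \<open>P\<close>, then \<open>1 / x\<close> would vanish there and \<open>P\<close>
  would be the point at infinity. With \<open>x\<close> also \<open>y\<close> is regular, because \<open>y\<^sup>2 = f(x)\<close>.
\<close>

lemma real_section_in_point:
  assumes P: "P \<in> normalization_points f" "P \<noteq> point_infinity f"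
  shows "(to_fract p, to_fract q) \<in> P"
proof -
  obtain A B M where "normalization_point f A B M P"
    using normalization_pointE[OF P(1) zero.K_field] by blast
  then interpret P: normalization_point f A B M P .
  have AP: "A \<subseteq> P" using P.A_subset_B P.B_subset_P by blast
  have "x_fun \<in> A \<or> inv\<^bsub>K\<^esub> x_fun \<in> A"
    using P.A unfolding chart_rings_def by (auto intro: generate_ring.incl)
  then have x: "(xr, 0) \<in> P"
  proof
    assume "x_fun \<in> A"
    then show ?thesis using AP by (auto simp: x_fun_def)
  next
    assume "inv\<^bsub>K\<^esub> x_fun \<in> A"
    then have T: "(1 / xr, 0) \<in> P" using AP by (auto simp: inv_x)
    have "(1 / xr, 0) \<notin> local_max_ideal f P"
      using infty.point_unique[OF P(1)] P(2) point_infinity_V by blast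
    then have "(1 / xr, 0) \<in> Units (K\<lparr>carrier := P\<rparr>)"
      using T by (simp add: local_max_ideal_def)
    then obtain u where u: "u \<in> P" "(1 / xr, 0) \<otimes>\<^bsub>K\<^esub> u = (1, 0)"
      unfolding Units_def by auto
    obtain u1 u2 where "u = (u1, u2)" by (cases u)
    then have "u = (xr, 0)" using u(2) by (simp add: field_simps)
    then show ?thesis using u(1) by simp
  qed
  have poly: "(to_fract r, 0) \<in> P" for r
    using ev_closed[OF P.P_add P.P_mult P.P_const x, of r] by (simp add: ev_xr)
  have y: "(0, 1) \<in> P"
    using P.P_sqrt[of "(0, 1)"] poly[of f] by simp
  show ?thesis
    using P.P_add[OF poly[of p] P.P_mult[OF poly[of q] y]] by simp
qed

lemma zero_ne_infty: "zero.V \<noteq> infty.V"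
proof -
  have "(xr, 0) \<in> zero.V" using ord_pt.level_iff[of xr 0 0 f 0] poly_in_vball_pt[of "[:0, 1:] ^ 2" 0]
    by (simp add: zero.V_def power2_eq_square flip: to_fract_mult)
  moreover have "(xr, 0) \<notin> infty.V"
    using infty.kval_formula[of xr 0] ord_infty_xr by (simp add: infty.V_iff)
  ultimately show ?thesis by blast
qed

end


section \<open>The linear series as a space of pairs of polynomials\<close>

definition polys_below :: "nat \<Rightarrow> complex poly set" where
  "polys_below n = {p. \<forall>i \<ge> n. Polynomial.coeff p i = 0}"

definition real_polys_below :: "nat \<Rightarrow> complex poly set" where
  "real_polys_below n = {p \<in> polys_below n. real_poly p}"

lemma real_polys_below_0: "real_polys_below 0 = {0}"
proof -
  have "p = 0" if "\<forall>i. Polynomial.coeff p i = 0" for p :: "complex poly"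
    using that by (intro poly_eqI) simp
  then show ?thesis by (auto simp: real_polys_below_def polys_below_def real_poly_def)
qed

lemma real_polys_below_Suc:
  "real_polys_below (Suc n) = {p + Polynomial.monom c n | p c. p \<in> real_polys_below n \<and> c \<in> \<real>}"
proof (intro equalityI subsetI)
  fix p assume p: "p \<in> real_polys_below (Suc n)"
  define r where "r = p - Polynomial.monom (Polynomial.coeff p n) n"
  have coeff_r: "Polynomial.coeff r i = (if i = n then 0 else Polynomial.coeff p i)" for i
    by (simp add: r_def)
  have "r \<in> real_polys_below n"
    using p by (simp add: real_polys_below_def polys_below_def real_poly_def coeff_r)
  moreover have "p = r + Polynomial.monom (Polynomial.coeff p n) n" by (simp add: r_def)
  moreover have "Polynomial.coeff p n \<in> \<real>"
    using p by (simp add: real_polys_below_def real_poly_def)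
  ultimately show "p \<in> {p + Polynomial.monom c n | p c. p \<in> real_polys_below n \<and> c \<in> \<real>}"
    by blast
next
  fix p assume "p \<in> {p + Polynomial.monom c n | p c. p \<in> real_polys_below n \<and> c \<in> \<real>}"
  then obtain r c where "p = r + Polynomial.monom c n" "r \<in> real_polys_below n" "c \<in> \<real>"
    by blast
  then show "p \<in> real_polys_below (Suc n)"
    by (simp add: real_polys_below_def polys_below_def real_poly_def)
qed

text \<open>
  The two blocks of generators \<open>x\<^sup>i\<close> and \<open>x\<^sup>i y\<close> are handled at once: \<open>emb\<close> is \<open>p \<mapsto> p\<close> for the first and
  \<open>p \<mapsto> p y\<close> for the second. The set \<open>E\<close> is the span of the generators that follow in the list.
\<close>

lemma span_powers:
  assumes u: "\<And>c i. const_fun c \<otimes>\<^bsub>function_field f\<^esub> u i = emb (Polynomial.monom c i)"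
    and add: "\<And>p q. emb (p + q) = emb p \<oplus>\<^bsub>function_field f\<^esub> emb q"
    and zero: "emb 0 = (0, 0)"
  shows "foldr (ring.line_extension (function_field f) (const_fun ` \<real>)) (map u [0..<n]) E =
    {emb p \<oplus>\<^bsub>function_field f\<^esub> e | p e. p \<in> real_polys_below n \<and> e \<in> E}"
proof (induction n arbitrary: E)
  case 0
  have "(0, 0) \<oplus>\<^bsub>function_field f\<^esub> e = e" for e by (cases e) simp
  then show ?case by (simp add: real_polys_below_0 zero)
next
  case (Suc n)
  let ?K = "function_field f"
  interpret cring ?K by (rule ff_cring)
  have assoc: "emb p \<oplus>\<^bsub>?K\<^esub> (emb q \<oplus>\<^bsub>?K\<^esub> e) = emb (p + q) \<oplus>\<^bsub>?K\<^esub> e" for p q e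
    unfolding add by (rule a_assoc[symmetric]) simp_all
  have "line_extension (const_fun ` \<real>) (u n) E =
      {emb (Polynomial.monom c n) \<oplus>\<^bsub>?K\<^esub> e | c e. c \<in> \<real> \<and> e \<in> E}"
    unfolding set_eq_iff line_extension_mem_iff bex_simps(7) u by blast
  then have "foldr (line_extension (const_fun ` \<real>)) (map u [0..<Suc n]) E =
      {emb p \<oplus>\<^bsub>?K\<^esub> e | p e. p \<in> real_polys_below n \<and>
        e \<in> {emb (Polynomial.monom c n) \<oplus>\<^bsub>?K\<^esub> e | c e. c \<in> \<real> \<and> e \<in> E}}"
    using Suc.IH by simp
  also have "\<dots> = {emb (p + Polynomial.monom c n) \<oplus>\<^bsub>?K\<^esub> e | p c e.
      p \<in> real_polys_below n \<and> c \<in> \<real> \<and> e \<in> E}"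
    unfolding assoc[symmetric] by blast
  also have "\<dots> = {emb p \<oplus>\<^bsub>?K\<^esub> e | p e. p \<in> real_polys_below (Suc n) \<and> e \<in> E}"
    unfolding real_polys_below_Suc by blast
  finally show ?case .
qed

lemma const_mult_xr_power: "to_fract [:c:] * xr ^ i = to_fract (Polynomial.monom c i)"
proof -
  have "Polynomial.monom c i = [:c:] * Polynomial.monom 1 i"
    by (simp add: smult_monom)
  then show ?thesis unfolding xr_power by (metis to_fract_mult)
qed

lemma linear_series_eq:
  "linear_series g k f =
    {(to_fract p, to_fract q) | p q. p \<in> real_polys_below (k + 1) \<and> q \<in> real_polys_below (k - g)}"
proof -
  let ?K = "function_field f"
  interpret cring ?K by (rule ff_cring)
  have x: "const_fun c \<otimes>\<^bsub>?K\<^esub> (x_fun [^]\<^bsub>?K\<^esub> i) = (to_fract (Polynomial.monom c i), 0)" for c and i :: nat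
    by (simp add: const_fun_def x_fun_def const_mult_xr_power)
  have y: "const_fun c \<otimes>\<^bsub>?K\<^esub> ((x_fun [^]\<^bsub>?K\<^esub> i) \<otimes>\<^bsub>?K\<^esub> y_fun) = (0, to_fract (Polynomial.monom c i))" for c and i :: nat
    by (simp add: const_fun_def x_fun_def y_fun_def const_mult_xr_power)
  have 1: "foldr (line_extension (const_fun ` \<real>)) (map (\<lambda>i. (x_fun [^]\<^bsub>?K\<^esub> i) \<otimes>\<^bsub>?K\<^esub> y_fun) [0..<k - g]) {(0, 0)} =
      {(0, to_fract q) | q. q \<in> real_polys_below (k - g)}"
    by (subst span_powers[where emb = "\<lambda>q. (0, to_fract q)", OF y]) auto
  have 2: "foldr (line_extension (const_fun ` \<real>)) (map (\<lambda>i. x_fun [^]\<^bsub>?K\<^esub> i) [0..<k + 1]) E =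
      {(to_fract p, 0) \<oplus>\<^bsub>?K\<^esub> e | p e. p \<in> real_polys_below (k + 1) \<and> e \<in> E}" for E
    by (rule span_powers[where emb = "\<lambda>p. (to_fract p, 0)", OF x]) auto
  have "linear_series g k f =
      {(to_fract p, 0) \<oplus>\<^bsub>?K\<^esub> e | p e. p \<in> real_polys_below (k + 1) \<and>
        e \<in> {(0, to_fract q) | q. q \<in> real_polys_below (k - g)}}"
    unfolding linear_series_def Span.simps foldr_append ff_simps(3) 1 2 ..
  then show ?thesis by fastforce
qed

lemma polys_below_complexify:
  "p \<in> polys_below n \<longleftrightarrow> (\<exists>p1 p2. p1 \<in> real_polys_below n \<and> p2 \<in> real_polys_below n \<and>
    p = p1 + [:\<i>:] * p2)"
proof
  assume p: "p \<in> polys_below n"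
  define p1 where "p1 = map_poly (\<lambda>z. complex_of_real (Re z)) p"
  define p2 where "p2 = map_poly (\<lambda>z. complex_of_real (Im z)) p"
  have "p1 \<in> real_polys_below n" "p2 \<in> real_polys_below n"
    using p by (auto simp: p1_def p2_def real_polys_below_def polys_below_def real_poly_def coeff_map_poly)
  moreover have "p = p1 + [:\<i>:] * p2"
    by (rule poly_eqI) (simp add: p1_def p2_def coeff_map_poly complex_eq_iff)
  ultimately show "\<exists>p1 p2. p1 \<in> real_polys_below n \<and> p2 \<in> real_polys_below n \<and> p = p1 + [:\<i>:] * p2"
    by blast
qed (auto simp: real_polys_below_def polys_below_def)

lemma complexification_linear_series:
  "complexification f (linear_series g k f) =
    {(to_fract p, to_fract q) | p q. p \<in> polys_below (k + 1) \<and> q \<in> polys_below (k - g)}"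
proof -
  have add: "(to_fract p1, to_fract q1) \<oplus>\<^bsub>function_field f\<^esub> (const_fun \<i> \<otimes>\<^bsub>function_field f\<^esub> (to_fract p2, to_fract q2))
      = (to_fract (p1 + [:\<i>:] * p2), to_fract (q1 + [:\<i>:] * q2))" for p1 q1 p2 q2
    unfolding to_fract_add to_fract_mult by (simp add: const_fun_def)
  have "complexification f (linear_series g k f) =
      {(to_fract (p1 + [:\<i>:] * p2), to_fract (q1 + [:\<i>:] * q2)) | p1 q1 p2 q2.
        p1 \<in> real_polys_below (k + 1) \<and> p2 \<in> real_polys_below (k + 1) \<and>
        q1 \<in> real_polys_below (k - g) \<and> q2 \<in> real_polys_below (k - g)}"
    unfolding complexification_def linear_series_eq by (force simp only: add[symmetric])
  then show ?thesis unfolding polys_below_complexify by fastforce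
qed

text \<open>
  The value of \<open>p + q y\<close> is attained by one of its two terms, whose value is that of a monomial. For the
  place \<open>0\<close> one takes \<open>\<sigma> = 1\<close> and the order at \<open>0\<close> for \<open>d\<close>, for the place \<open>\<infinity>\<close> one takes \<open>\<sigma> = -1\<close> and the degree.
\<close>

lemma (in ramified_valuation) kval_image:
  fixes \<sigma> :: int and d :: "complex poly \<Rightarrow> nat"
  assumes val: "\<And>p. p \<noteq> 0 \<Longrightarrow> \<nu> (to_fract p) = \<sigma> * int (d p)"
    and below: "\<And>n p. p \<noteq> 0 \<Longrightarrow> p \<in> polys_below n \<Longrightarrow> d p < n"
    and monom: "\<And>i. d (Polynomial.monom 1 i) = i"
  shows "kval ` ({(to_fract p, to_fract q) | p q. p \<in> polys_below m \<and> q \<in> polys_below n} - {(0, 0)}) =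
    (\<lambda>i. 2 * \<sigma> * int i) ` {..<m} \<union> (\<lambda>i. 2 * \<sigma> * int i + \<nu> (to_fract f)) ` {..<n}"
    (is "kval ` ?H = ?X \<union> ?Y")
proof (intro equalityI subsetI)
  fix z assume "z \<in> kval ` ?H"
  then obtain h where h: "z = kval h" "h \<in> ?H" by blast
  then obtain p q where pq': "h = (to_fract p, to_fract q)" "p \<in> polys_below m" "q \<in> polys_below n"
    by blast
  then have pq: "p \<in> polys_below m" "q \<in> polys_below n" "p \<noteq> 0 \<or> q \<noteq> 0"
    and z: "z = kval (to_fract p, to_fract q)"
    using h by auto
  have p: "2 * \<nu> (to_fract p) \<in> ?X" if "p \<noteq> 0"
    using val[OF that] below[OF that pq(1)] by auto
  have q: "2 * \<nu> (to_fract q) + \<nu> (to_fract f) \<in> ?Y" if "q \<noteq> 0"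
    using val[OF that] below[OF that pq(2)] by auto
  show "z \<in> ?X \<union> ?Y"
    using kval_formula[of "to_fract p" "to_fract q"] pq(3) p q unfolding z min_def
    by (auto split: if_splits)
next
  fix z assume "z \<in> ?X \<union> ?Y"
  then show "z \<in> kval ` ?H"
  proof
    assume "z \<in> ?X"
    then obtain i where i: "z = 2 * \<sigma> * int i" "i < m" by auto
    have "(to_fract (Polynomial.monom 1 i), to_fract 0) \<in> ?H"
      using i(2) by (auto simp: polys_below_def)
    moreover have "kval (to_fract (Polynomial.monom 1 i), to_fract 0) = z"
      using kval_formula[of "to_fract (Polynomial.monom 1 i)" 0] val[of "Polynomial.monom 1 i"]
      by (simp add: monom i(1))
    ultimately show ?thesis by blast
  next
    assume "z \<in> ?Y"
    then obtain i where i: "z = 2 * \<sigma> * int i + \<nu> (to_fract f)" "i < n" by auto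
    have "(to_fract 0, to_fract (Polynomial.monom 1 i)) \<in> ?H"
      using i(2) by (auto simp: polys_below_def)
    moreover have "kval (to_fract 0, to_fract (Polynomial.monom 1 i)) = z"
      using kval_formula[of 0 "to_fract (Polynomial.monom 1 i)"] val[of "Polynomial.monom 1 i"]
      by (simp add: monom i(1))
    ultimately show ?thesis by blast
  qed
qed


section \<open>Vanishing sequences\<close>

context curve
begin

lemma degree_below: "p \<noteq> 0 \<Longrightarrow> p \<in> polys_below n \<Longrightarrow> Polynomial.degree p < n"
  by (metis (mono_tags) leading_coeff_0_iff mem_Collect_eq not_le polys_below_def)

lemma vanishing_orders_zero:
  "vanishing_sequence f N (linear_series g' k f) (point_zero f) = sorted_list_of_set
    ((\<lambda>i. 2 * int i) ` {..<k + 1} \<union> (\<lambda>i. 2 * int i + (2 * int j - 1)) ` {..<k - g'})"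
proof -
  have "vanishing_order f N (point_zero f) h = zero.kval h" if "h \<noteq> (0, 0)" for h
    using that zero_ne_infty
    by (simp add: vanishing_order_def point_zero_V point_infinity_V zero.ord_at_V)
  then have "vanishing_order f N (point_zero f) `
      (complexification f (linear_series g' k f) - {\<zero>\<^bsub>function_field f\<^esub>}) =
      zero.kval ` (complexification f (linear_series g' k f) - {(0, 0)})"
    by (intro image_cong) auto
  also have "\<dots> = (\<lambda>i. 2 * 1 * int i) ` {..<k + 1} \<union>
      (\<lambda>i. 2 * 1 * int i + ord_pt 0 (to_fract f)) ` {..<k - g'}"
    unfolding complexification_linear_series
  proof (rule zero.kval_image)
    show "p \<noteq> 0 \<Longrightarrow> ord_pt 0 (to_fract p) = 1 * int (Polynomial.order 0 p)" for p
      by (simp add: ord_pt_poly)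
    show "p \<noteq> 0 \<Longrightarrow> p \<in> polys_below n \<Longrightarrow> Polynomial.order 0 p < n" for n p
      using degree_below[of p n] order_degree[of p 0] by linarith
    show "Polynomial.order 0 (Polynomial.monom (1 :: complex) i) = i" for i
      by simp
  qed
  also have "ord_pt 0 (to_fract f) = 2 * int j - 1"
    using f_nz j by (simp add: ord_pt_poly order_f)
  finally show ?thesis by (simp add: vanishing_sequence_def)
qed

lemma kval_infty:
  "infty.kval ` (complexification f (linear_series g' k f) - {(0, 0)}) =
    (\<lambda>i. 2 * (- 1) * int i) ` {..<k + 1} \<union>
    (\<lambda>i. 2 * (- 1) * int i + ord_infty (to_fract f)) ` {..<k - g'}"
  unfolding complexification_linear_series
proof (rule infty.kval_image)
  show "p \<noteq> 0 \<Longrightarrow> ord_infty (to_fract p) = - 1 * int (Polynomial.degree p)" for p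
    by (simp add: ord_infty_poly)
qed (auto simp: degree_below degree_monom_eq)

lemma vanishing_orders_infty:
  "vanishing_sequence f N (linear_series g' k f) (point_infinity f) = sorted_list_of_set
    ((\<lambda>z. int N - z) ` ((\<lambda>i. 2 * int i) ` {..<k + 1} \<union> (\<lambda>i. 2 * int i + (2 * int j + 1)) ` {..<k - g'}))"
proof -
  have "vanishing_order f N (point_infinity f) h = int N + infty.kval h" if "h \<noteq> (0, 0)" for h
    using that by (simp add: vanishing_order_def point_infinity_V infty.ord_at_V)
  then have "vanishing_order f N (point_infinity f) `
      (complexification f (linear_series g' k f) - {\<zero>\<^bsub>function_field f\<^esub>}) =
      (+) (int N) ` infty.kval ` (complexification f (linear_series g' k f) - {(0, 0)})"
    unfolding image_image by (intro image_cong) auto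
  also have "\<dots> = (\<lambda>z. int N - z) ` ((\<lambda>i. 2 * int i) ` {..<k + 1} \<union> (\<lambda>i. 2 * int i + (2 * int j + 1)) ` {..<k - g'})"
    unfolding kval_infty ord_infty_f image_Un image_image by (simp add: algebra_simps)
  finally show ?thesis by (simp add: vanishing_sequence_def)
qed

lemma linear_series_real_sections:
  assumes "j \<le> g'" "g' \<le> k"
  shows "linear_series g' k f \<subseteq> real_sections f (2 * k)"
proof
  fix h assume h: "h \<in> linear_series g' k f"
  then obtain p q where pq: "h = (to_fract p, to_fract q)"
    "p \<in> real_polys_below (k + 1)" "q \<in> real_polys_below (k - g')"
    unfolding linear_series_eq by blast
  have "to_fract r \<in> real_ratfuns" if "real_poly r" for r
  proof -
    have "real_poly 1"
      by (simp add: real_poly_def one_pCons coeff_pCons split: nat.split)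
    then have "to_fract r = to_fract r / to_fract 1 \<and> real_poly r \<and> real_poly 1 \<and> (1 :: complex poly) \<noteq> 0"
      using that by simp
    then show ?thesis unfolding real_ratfuns_def by blast
  qed
  then have "h \<in> real_functions"
    using pq by (simp add: real_functions_def real_polys_below_def)
  moreover have "- int (2 * k) \<le> ord_at f (point_infinity f) h" if h0: "h \<noteq> (0, 0)"
  proof -
    have "h \<in> complexification f (linear_series g' k f)"
      unfolding complexification_linear_series using pq by (auto simp: real_polys_below_def)
    then have "infty.kval h \<in> (\<lambda>i. 2 * (- 1) * int i) ` {..<k + 1} \<union>
        (\<lambda>i. 2 * (- 1) * int i + ord_infty (to_fract f)) ` {..<k - g'}"
      unfolding kval_infty[symmetric] using h0 by blast
    then have "- int (2 * k) \<le> infty.kval h"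
      using assms by (auto simp: ord_infty_f)
    then show ?thesis by (simp add: point_infinity_V infty.ord_at_V[OF h0])
  qed
  ultimately show "h \<in> real_sections f (2 * k)"
    unfolding real_sections_def using real_section_in_point pq(1) by simp
qed

end

lemma sorted_list_of_set_reflect:
  fixes D :: "int set"
  assumes "finite D"
  shows "sorted_list_of_set ((\<lambda>z. c - z) ` D) = rev (map (\<lambda>z. c - z) (sorted_list_of_set D))"
proof (rule sorted_distinct_set_unique)
  have "sorted_wrt (\<lambda>x y. c - y \<le> c - x) (sorted_list_of_set D)"
    using sorted_sorted_list_of_set[of D] by simp
  then show "sorted (rev (map (\<lambda>z. c - z) (sorted_list_of_set D)))"
    by (simp add: sorted_wrt_rev sorted_wrt_map)
  show "distinct (rev (map (\<lambda>z. c - z) (sorted_list_of_set D)))"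
    by (simp add: distinct_map inj_on_def)
qed (use assms in simp_all)

theorem corollary5p4:
  fixes g k :: nat
    and \<beta> \<alpha>1 \<alpha>2 :: "nat \<Rightarrow> complex"
    and f :: "nat \<Rightarrow> complex poly"
    and H :: "nat \<Rightarrow> (ratfun \<times> ratfun) set"
  assumes "2 \<le> g" and "g \<le> k"
    and "\<And>j. j \<in> {1..g} \<Longrightarrow> \<beta> j \<noteq> 0 \<and> \<alpha>1 j \<noteq> 0 \<and> \<alpha>2 j \<noteq> 0 \<and> \<alpha>1 j \<noteq> \<alpha>2 j"
    and "\<And>j. j \<in> {1..g} \<Longrightarrow> f j = curve_poly j (\<beta> j) (\<alpha>1 j) (\<alpha>2 j)"
    and "\<And>j. j \<in> {1..g} \<Longrightarrow> real_poly (f j)"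
    and "\<And>j. j \<in> {1..g} \<Longrightarrow> H j = linear_series g k (f j)"
  shows "(\<forall>j \<in> {1..g}. H j \<subseteq> real_sections (f j) (2 * k)) \<and>
    (\<forall>j \<in> {1..g - 1}.
       length (vanishing_sequence (f j) (2 * k) (H j) (point_infinity (f j))) = 2 * k - g + 1 \<and>
       length (vanishing_sequence (f (j + 1)) (2 * k) (H (j + 1)) (point_zero (f (j + 1)))) = 2 * k - g + 1 \<and>
       (\<forall>i \<in> {0..2 * k - g}.
          vanishing_sequence (f j) (2 * k) (H j) (point_infinity (f j)) ! i +
          vanishing_sequence (f (j + 1)) (2 * k) (H (j + 1)) (point_zero (f (j + 1))) ! (2 * k - g - i)
          = int (2 * k)))"
proof (intro conjI ballI)
  fix j assume j: "j \<in> {1..g}"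
  interpret C: curve j "\<beta> j" "\<alpha>1 j" "\<alpha>2 j" "f j"
    using assms(3,4)[OF j] j by unfold_locales auto
  show "H j \<subseteq> real_sections (f j) (2 * k)"
    unfolding assms(6)[OF j] using C.linear_series_real_sections[of g k] j assms(2) by simp
next
  fix j assume "j \<in> {1..g - 1}"
  then have j: "j \<in> {1..g}" "j + 1 \<in> {1..g}" by auto
  interpret C: curve j "\<beta> j" "\<alpha>1 j" "\<alpha>2 j" "f j"
    using assms(3,4)[OF j(1)] j by unfold_locales auto
  interpret D: curve "j + 1" "\<beta> (j + 1)" "\<alpha>1 (j + 1)" "\<alpha>2 (j + 1)" "f (j + 1)"
    using assms(3,4)[OF j(2)] j by unfold_locales auto
  define Y Z where "Y = (\<lambda>i. 2 * int i) ` {..<k + 1}"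
    and "Z = (\<lambda>i. 2 * int i + (2 * int j + 1)) ` {..<k - g}"
  let ?o = "vanishing_sequence (f j) (2 * k) (H j) (point_infinity (f j))"
  let ?o' = "vanishing_sequence (f (j + 1)) (2 * k) (H (j + 1)) (point_zero (f (j + 1)))"
  have "2 * int (j + 1) - 1 = 2 * int j + 1" by simp
  then have zero: "?o' = sorted_list_of_set (Y \<union> Z)"
    unfolding assms(6)[OF j(2)] D.vanishing_orders_zero Y_def Z_def by (simp only:)
  have "?o = sorted_list_of_set ((\<lambda>z. int (2 * k) - z) ` (Y \<union> Z))"
    unfolding assms(6)[OF j(1)] C.vanishing_orders_infty Y_def Z_def ..
  then have infty: "?o = rev (map (\<lambda>z. int (2 * k) - z) (sorted_list_of_set (Y \<union> Z)))"
    by (simp only: sorted_list_of_set_reflect Y_def Z_def finite_Un finite_imageI finite_lessThan simp_thms)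
  have "Y \<inter> Z = {}"
    unfolding Y_def Z_def by auto presburger
  moreover have "card Y = k + 1" "card Z = k - g"
    unfolding Y_def Z_def by (subst card_image; simp add: inj_on_def)+
  moreover have "finite Y" "finite Z" by (simp_all add: Y_def Z_def)
  ultimately have len: "length (sorted_list_of_set (Y \<union> Z)) = 2 * k - g + 1"
    using assms(2) by (simp add: card_Un_disjoint)
  show "length ?o = 2 * k - g + 1" "length ?o' = 2 * k - g + 1"
    unfolding zero infty using len by simp_all
  fix i assume "i \<in> {0..2 * k - g}"
  then show "?o ! i + ?o' ! (2 * k - g - i) = int (2 * k)"
    unfolding zero infty using len by (simp add: rev_nth)
qed

end
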